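(* Consider the $3$-graphs on vertex set $\{1,\dots,6\}$ \[ G_1=\{123,124,134,235,245,156\},\qquad G_2=\{123,124,135,345,146,256\}. \] Neither $G_1$ nor $G_2$ is $(2,1)$-colourable, and $\pi(G_1)=\pi(G_2)=4/9$.
   Context: A $3$-graph is a pair $(V,E)$ where $V$ is a finite vertex set and $E$ is a set of $3$-element subsets of $V$ (edges); it is identified with its edge set, and $abc$ denotes the edge $\{a,b,c\}$. $e(G)$ is the number of edges of $G$. For a family $\mathcal{F}$ of $3$-graphs, a $3$-graph is $\mathcal{F}$-free if it contains no (not necessarily induced) subgraph isomorphic to a member of $\mathcal{F}$. Define $\mathrm{ex}(n,\mathcal{F})=\max\{e(G): G \text{ is } \mathcal{F}\text{-free}, |V(G)|=n\}$ and the Turán density $\pi(\mathcal{F})=\lim_{n\to\infty}\mathrm{ex}(n,\mathcal{F})/\binom{n}{3}$ (the limit always exists). For a single $3$-graph $F$, $\pi(F)=\pi(\{F\})$. For a bipartition $[n]=V_0\cup V_1$, where $[n]=\{1,\dots,n\}$, let $J(V_0,V_1)$ be the $3$-graph with vertex set $[n]$ whose edges are all triples meeting $V_0$ in exactly two vertices and $V_1$ in exactly one vertex. A $3$-graph is $(2,1)$-colourable if it is isomorphic to a subgraph of $J(V_0,V_1)$ for some bipartition $[n]=V_0\cup V_1$. *)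

theory Defs
  imports Complex_Main
begin

type_synonym 'a hypergraph = "'a set \<times> 'a set set"

abbreviation verts :: "'a hypergraph \<Rightarrow> 'a set" where
  "verts G \<equiv> fst G"

abbreviation edges :: "'a hypergraph \<Rightarrow> 'a set set" where
  "edges G \<equiv> snd G"

definition three_graph :: "'a hypergraph \<Rightarrow> bool" where
  "three_graph G \<longleftrightarrow> finite (verts G) \<and> (\<forall>e\<in>edges G. e \<subseteq> verts G \<and> card e = 3)"

definition subgraph :: "'a hypergraph \<Rightarrow> 'a hypergraph \<Rightarrow> bool" where
  "subgraph H G \<longleftrightarrow> three_graph H \<and> verts H \<subseteq> verts G \<and> edges H \<subseteq> edges G"

definition isomorphic :: "'a hypergraph \<Rightarrow> 'b hypergraph \<Rightarrow> bool" where
  "isomorphic F H \<longleftrightarrow>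
     (\<exists>f. bij_betw f (verts F) (verts H) \<and> (\<lambda>e. f ` e) ` edges F = edges H)"

definition free_of :: "'a hypergraph set \<Rightarrow> 'b hypergraph \<Rightarrow> bool" where
  "free_of \<F> G \<longleftrightarrow> \<not> (\<exists>F\<in>\<F>. \<exists>H. subgraph H G \<and> isomorphic F H)"

text \<open>
  Host graphs live on vertex sets of natural numbers; every finite \<open>3\<close>-graph is isomorphic
  to such a graph. The set below is always finite, since a graph on \<open>n\<close> vertices has at most
  \<open>n choose 3\<close> edges. It is nonempty for every \<open>n\<close> if all members of the family have an edge.
\<close>

definition turan_number :: "nat \<Rightarrow> 'a hypergraph set \<Rightarrow> nat" where
  "turan_number n \<F> =
     Max {card (edges G) | G :: nat hypergraph.
            three_graph G \<and> card (verts G) = n \<and> free_of \<F> G}"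

definition turan_density :: "'a hypergraph set \<Rightarrow> real" where
  "turan_density \<F> = lim (\<lambda>n. real (turan_number n \<F>) / real (n choose 3))"

definition J :: "'a set \<Rightarrow> 'a set \<Rightarrow> 'a hypergraph" where
  "J V0 V1 =
     (V0 \<union> V1,
      {e. e \<subseteq> V0 \<union> V1 \<and> card e = 3 \<and> card (e \<inter> V0) = 2 \<and> card (e \<inter> V1) = 1})"

definition colourable_2_1 :: "'a hypergraph \<Rightarrow> bool" where
  "colourable_2_1 F \<longleftrightarrow>
     (\<exists>(n::nat) V0 V1 H. V0 \<union> V1 = {1..n} \<and> V0 \<inter> V1 = {} \<and>
        subgraph H (J V0 V1) \<and> isomorphic F H)"

definition G1 :: "nat hypergraph" where
  "G1 = ({1..6}, {{1,2,3}, {1,2,4}, {1,3,4}, {2,3,5}, {2,4,5}, {1,5,6}})"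

definition G2 :: "nat hypergraph" where
  "G2 = ({1..6}, {{1,2,3}, {1,2,4}, {1,3,5}, {3,4,5}, {1,4,6}, {2,5,6}})"

lemma three_graph_G1: "three_graph G1"
  by (simp add: three_graph_def G1_def)

lemma three_graph_G2: "three_graph G2"
  by (simp add: three_graph_def G2_def)

end

theory Submission
  imports Defs "HOL-Real_Asymp.Real_Asymp"
begin

text \<open>
  Why the density is 4/9. In $J(V_0,V_1)$ with $|V_0| = 2n/3$ there are about $\frac{4}{9}\binom{n}{3}$
  edges, and it contains no copy of a 3-graph that is not (2,1)-colourable; in \<open>G1\<close> and in \<open>G2\<close> the
  requirement that every edge has exactly one vertex in $V_1$ is contradictory. This gives the lower
  bound.

  For the upper bound the two 3-graphs are treated together. Both map homomorphically onto the same
  five-vertex 3-graph \<open>F\<close> with edges $vxa, vxb, vxy, vya, vyb, xab$, in such a way that only $v$ has two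
  preimages. If two copies of \<open>F\<close> differ only in the vertex that plays $v$, they therefore span a copy of
  \<open>G1\<close> and a copy of \<open>G2\<close>. So a graph on $n$ vertices that is free of one of them has at most $n^4$
  labelled copies of \<open>F\<close>, and all but $O(n^5)$ of its six-tuples have distinct entries and span no copy
  of \<open>F\<close>.

  On such a six-tuple a finite inequality holds (\<open>six_value\<close> is at most $0$). Its leading part is
  $38400(q - 2e)$, where $q$ counts the pairs of edges that meet in exactly one vertex and $e$ counts the
  edges. The rest is a combination of products of two linear functionals, one for each of the two
  vertices outside a fixed four-set; summed over all six-tuples of the whole graph these products become
  squares. Hence \<open>local_term\<close>, whose sum over the orderings of a six-set is a multiple of \<open>six_value\<close>, has
  a total of at most $O(n^5)$ and of at least $6400(9n\sum_v D_v^2 - 4n^3 S)$, where $D_v$ is the number of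
  ordered pairs that form an edge with $v$ and $S = \sum_v D_v = 6e(G)$. With the Cauchy--Schwarz
  inequality $S^2 \le n \sum_v D_v^2$ this gives $S(9S - 4n^3) = O(n^5)$, that is
  $S \le \frac{4}{9}n^3 + O(n^2)$ (\<open>edge_bound\<close>).

  The finite inequality is a flag-algebra certificate. It is tight on the induced subgraphs of the
  extremal graph, so every functional must average to $0$ there; this determines most of the shape of
  the coefficients. It is verified for the six-vertex graphs in a canonical ordering
  (\<open>roots_checked\<close>), to which the general case reduces by choosing a suitable ordering of the six
  vertices (\<open>good_ordering\<close>).
\<close>

section \<open>Colourability and the lower bound\<close>

text \<open>The set $V_1$, pulled back to the vertices of the 3-graph, is recorded as a Boolean colouring.\<close>

lemma colouring_of_colourable:
  assumes F: "three_graph F" and col: "colourable_2_1 F"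
  obtains c :: "'a \<Rightarrow> bool" where "\<And>e. e \<in> edges F \<Longrightarrow> card {v\<in>e. c v} = 1"
proof -
  obtain n :: nat and V0 V1 H where part: "V0 \<union> V1 = {1..n}" "V0 \<inter> V1 = {}"
      and sub: "subgraph H (J V0 V1)" and iso: "isomorphic F H"
    using col unfolding colourable_2_1_def by blast
  obtain f where f: "bij_betw f (verts F) (verts H)"
      and fe: "(\<lambda>e. f ` e) ` edges F = edges H"
    using iso unfolding isomorphic_def by blast
  have "card {v\<in>e. f v \<in> V1} = 1" if e: "e \<in> edges F" for e
  proof -
    have "e \<subseteq> verts F" using F e by (auto simp: three_graph_def)
    then have inj: "inj_on f e" using f by (meson bij_betw_def inj_on_subset)
    have "f ` e \<in> edges (J V0 V1)" using sub fe e by (auto simp: subgraph_def)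
    then have "card (f ` e \<inter> V1) = 1" by (simp add: J_def)
    moreover have "f ` e \<inter> V1 = f ` {v\<in>e. f v \<in> V1}" by auto
    moreover have "inj_on f {v\<in>e. f v \<in> V1}" using inj by (rule inj_on_subset) auto
    ultimately show ?thesis by (simp add: card_image)
  qed
  then show thesis by (rule that)
qed

lemma one_coloured_of_three:
  assumes "card {v\<in>{x, y, z}. c v} = 1" "x \<noteq> y" "x \<noteq> z" "y \<noteq> z"
  shows "c x \<and> \<not> c y \<and> \<not> c z \<or> \<not> c x \<and> c y \<and> \<not> c z \<or> \<not> c x \<and> \<not> c y \<and> c z"
proof -
  have "{v\<in>{x, y, z}. c v} = (if c x then {x} else {}) \<union> (if c y then {y} else {}) \<union> (if c z then {z} else {})"
    by auto
  then show ?thesis using assms by (auto split: if_splits)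
qed

text \<open>Writing out that each edge has exactly one vertex of the second class leaves an unsatisfiable
  propositional formula in the six colours.\<close>

lemma G1_not_colourable: "\<not> colourable_2_1 G1"
proof
  assume "colourable_2_1 G1"
  then obtain c where c: "\<And>e. e \<in> edges G1 \<Longrightarrow> card {v\<in>e. c v} = 1"
    using colouring_of_colourable[OF three_graph_G1] by metis
  note one = one_coloured_of_three[OF c]
  have "c 1 \<and> \<not> c 2 \<and> \<not> c 3 \<or> \<not> c 1 \<and> c 2 \<and> \<not> c 3 \<or> \<not> c 1 \<and> \<not> c 2 \<and> c 3"
       "c 1 \<and> \<not> c 2 \<and> \<not> c 4 \<or> \<not> c 1 \<and> c 2 \<and> \<not> c 4 \<or> \<not> c 1 \<and> \<not> c 2 \<and> c 4"
       "c 1 \<and> \<not> c 3 \<and> \<not> c 4 \<or> \<not> c 1 \<and> c 3 \<and> \<not> c 4 \<or> \<not> c 1 \<and> \<not> c 3 \<and> c 4"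
       "c 2 \<and> \<not> c 3 \<and> \<not> c 5 \<or> \<not> c 2 \<and> c 3 \<and> \<not> c 5 \<or> \<not> c 2 \<and> \<not> c 3 \<and> c 5"
       "c 1 \<and> \<not> c 5 \<and> \<not> c 6 \<or> \<not> c 1 \<and> c 5 \<and> \<not> c 6 \<or> \<not> c 1 \<and> \<not> c 5 \<and> c 6"
    by (rule one; simp add: G1_def)+
  then show False by argo
qed

lemma G2_not_colourable: "\<not> colourable_2_1 G2"
proof
  assume "colourable_2_1 G2"
  then obtain c where c: "\<And>e. e \<in> edges G2 \<Longrightarrow> card {v\<in>e. c v} = 1"
    using colouring_of_colourable[OF three_graph_G2] by metis
  note one = one_coloured_of_three[OF c]
  have "c 1 \<and> \<not> c 2 \<and> \<not> c 3 \<or> \<not> c 1 \<and> c 2 \<and> \<not> c 3 \<or> \<not> c 1 \<and> \<not> c 2 \<and> c 3"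
       "c 1 \<and> \<not> c 2 \<and> \<not> c 4 \<or> \<not> c 1 \<and> c 2 \<and> \<not> c 4 \<or> \<not> c 1 \<and> \<not> c 2 \<and> c 4"
       "c 1 \<and> \<not> c 3 \<and> \<not> c 5 \<or> \<not> c 1 \<and> c 3 \<and> \<not> c 5 \<or> \<not> c 1 \<and> \<not> c 3 \<and> c 5"
       "c 3 \<and> \<not> c 4 \<and> \<not> c 5 \<or> \<not> c 3 \<and> c 4 \<and> \<not> c 5 \<or> \<not> c 3 \<and> \<not> c 4 \<and> c 5"
       "c 1 \<and> \<not> c 4 \<and> \<not> c 6 \<or> \<not> c 1 \<and> c 4 \<and> \<not> c 6 \<or> \<not> c 1 \<and> \<not> c 4 \<and> c 6"
       "c 2 \<and> \<not> c 5 \<and> \<not> c 6 \<or> \<not> c 2 \<and> c 5 \<and> \<not> c 6 \<or> \<not> c 2 \<and> \<not> c 5 \<and> c 6"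
    by (rule one; simp add: G2_def)+
  then show False by argo
qed

text \<open>Inserting a vertex of $V_1$ into a pair from $V_0$ loses no information, because the classes are
  disjoint.\<close>

lemma card_edges_J_ge:
  assumes fin: "finite V0" "finite V1" and disj: "V0 \<inter> V1 = {}"
  shows "(card V0 choose 2) * card V1 \<le> card (edges (J V0 V1))"
proof -
  let ?P = "{S. S \<subseteq> V0 \<and> card S = 2} \<times> V1"
  let ?f = "\<lambda>(S, v). insert v S"
  have inj: "inj_on ?f ?P"
  proof (rule inj_onI, clarify)
    fix S v S' v'
    assume S: "S \<subseteq> V0" "S' \<subseteq> V0" and v: "v \<in> V1" "v' \<in> V1" and eq: "insert v S = insert v' S'"
    have "S = insert v S \<inter> V0" "S' = insert v' S' \<inter> V0"
         "{v} = insert v S \<inter> V1" "{v'} = insert v' S' \<inter> V1"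
      using S v disj by auto
    then show "S = S' \<and> v = v'" using eq by (metis singleton_inject)
  qed
  have im: "?f ` ?P \<subseteq> edges (J V0 V1)"
  proof clarify
    fix S v assume S: "S \<subseteq> V0" "card S = 2" and v: "v \<in> V1"
    have "finite S" using S fin finite_subset by blast
    moreover have "v \<notin> S" using S v disj by auto
    moreover have "insert v S \<inter> V0 = S" "insert v S \<inter> V1 = {v}" using S v disj by auto
    ultimately show "insert v S \<in> edges (J V0 V1)" using S v by (auto simp: J_def)
  qed
  have "finite (edges (J V0 V1))"
    by (rule finite_subset[of _ "Pow (V0 \<union> V1)"]) (use fin in \<open>auto simp: J_def\<close>)
  then have "card ?P \<le> card (edges (J V0 V1))" using card_inj_on_le[OF inj im] by blast
  moreover have "card ?P = (card V0 choose 2) * card V1"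
    using n_subsets[OF fin(1), of 2] by (simp add: card_cartesian_product)
  ultimately show ?thesis by simp
qed

lemma card_edges_le:
  assumes "three_graph G"
  shows "card (edges G) \<le> card (verts G) choose 3"
proof -
  have "edges G \<subseteq> {e. e \<subseteq> verts G \<and> card e = 3}" "finite (verts G)"
    using assms by (auto simp: three_graph_def)
  then show ?thesis
    using card_mono[of "{e. e \<subseteq> verts G \<and> card e = 3}" "edges G"] n_subsets[of "verts G" 3]
    by simp
qed

lemma finite_edge_counts:
  "finite {card (edges G) |G :: nat hypergraph.
             three_graph G \<and> card (verts G) = n \<and> free_of \<F> G}"
  by (rule finite_subset[of _ "{..n choose 3}"]) (use card_edges_le in auto)

lemma J_member:
  fixes F :: "'a hypergraph"
  assumes "\<not> colourable_2_1 F" "k \<le> n"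
  shows "three_graph (J {1..k} {k+1..n}) \<and> card (verts (J {1..k} {k+1..n})) = n
         \<and> free_of {F} (J {1..k} {k+1..n})"
proof -
  have un: "{1..k} \<union> {k+1..n} = {1..n}" using assms(2) by auto
  have "three_graph (J {1..k} {k+1..n})" by (auto simp: three_graph_def J_def)
  moreover have "card (verts (J {1..k} {k+1..n})) = n" using un by (simp add: J_def)
  moreover have "free_of {F} (J {1..k} {k+1..n})"
    unfolding free_of_def
  proof clarsimp
    fix H1 H2 assume "subgraph (H1, H2) (J {Suc 0..k} {Suc k..n})" "isomorphic F (H1, H2)"
    then have "colourable_2_1 F"
      unfolding colourable_2_1_def using un
      by (intro exI[of _ n] exI[of _ "{1..k}"] exI[of _ "{k+1..n}"] exI[of _ "(H1,H2)"]) auto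
    then show False using assms by simp
  qed
  ultimately show ?thesis by blast
qed

lemma turan_number_ge:
  assumes "\<not> colourable_2_1 F" "k \<le> n"
  shows "(k choose 2) * (n - k) \<le> turan_number n {F}"
proof -
  have "(k choose 2) * (n - k) \<le> card (edges (J {1..k} {k+1..n}))"
    using card_edges_J_ge[of "{1..k}" "{k+1..n}"] by simp
  also have "\<dots> \<le> turan_number n {F}"
    unfolding turan_number_def
    by (rule Max_ge[OF finite_edge_counts]) (use J_member[OF assms] in blast)
  finally show ?thesis .
qed

lemma turan_number_le:
  assumes F: "\<not> colourable_2_1 F"
    and ub: "\<And>G :: nat hypergraph. three_graph G \<Longrightarrow> card (verts G) = n \<Longrightarrow> free_of {F} G
               \<Longrightarrow> real (card (edges G)) \<le> b"
  shows "real (turan_number n {F}) \<le> b"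
proof -
  let ?A = "{card (edges G) |G :: nat hypergraph.
             three_graph G \<and> card (verts G) = n \<and> free_of {F} G}"
  have "?A \<noteq> {}" using J_member[OF F, of 0 n] by blast
  then have "turan_number n {F} \<in> ?A"
    unfolding turan_number_def by (rule Max_in[OF finite_edge_counts])
  then show ?thesis using ub by auto
qed

text \<open>The lower bound comes from $J(V_0,V_1)$ with $|V_0| = \lfloor 2n/3 \rfloor$ or nearly so; the
  quadratic error term in the hypothesis vanishes against the number of triples.\<close>

lemma turan_density_eqI:
  assumes F: "\<not> colourable_2_1 F"
    and ub: "\<And>(G :: nat hypergraph) n. three_graph G \<Longrightarrow> card (verts G) = n \<Longrightarrow> free_of {F} G
               \<Longrightarrow> 6 * real (card (edges G)) \<le> 4 / 9 * real n ^ 3 + C * real n ^ 2"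
  shows "turan_density {F} = 4 / 9"
proof -
  let ?t = "\<lambda>n. real (turan_number n {F}) / real (n choose 3)"
  let ?k = "\<lambda>n::nat. 2 * real n / 3"
  have choose3: "real (n choose 3) = real n * (real n - 1) * (real n - 2) / 6" for n
  proof (cases "n < 2")
    case True then have "n = 0 \<or> n = 1" by auto
    then show ?thesis by auto
  next
    case False
    then show ?thesis
      by (simp add: binomial_gbinomial gbinomial_prod_rev numeral_3_eq_3 prod.atLeast0_lessThan_Suc fact_numeral)
  qed
  have choose2: "real (k choose 2) = real k * (real k - 1) / 2" for k
    by (cases k) (auto simp: choose_two field_simps real_of_nat_div)
  have lower: "(?k n - 1) * (?k n - 2) / 2 * (real n / 3) \<le> real (turan_number n {F})" if n: "n \<ge> 6" for n
  proof -
    define k where "k = 2 * n div 3"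
    have k: "?k n - 1 \<le> real k" "real k \<le> ?k n" "k \<le> n" using n unfolding k_def by linarith+
    have "(?k n - 1) * (?k n - 2) / 2 * (real n / 3) \<le> real k * (real k - 1) / 2 * (real n - real k)"
      using k n by (intro mult_mono divide_right_mono) auto
    also have "\<dots> = real ((k choose 2) * (n - k))" using k(3) by (simp add: choose2 of_nat_diff)
    also have "\<dots> \<le> real (turan_number n {F})"
      using turan_number_ge[OF F k(3)] by (simp only: of_nat_le_iff)
    finally show ?thesis .
  qed
  have upper: "real (turan_number n {F}) \<le> (4 / 9 * real n ^ 3 + C * real n ^ 2) / 6" for n
    using turan_number_le[OF F, of n "(4 / 9 * real n ^ 3 + C * real n ^ 2) / 6"] ub by fastforce
  have "?t \<longlonglongrightarrow> 4 / 9"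
  proof (rule real_tendsto_sandwich)
    show "\<forall>\<^sub>F n in sequentially. ((?k n - 1) * (?k n - 2) / 2 * (real n / 3)) /
            (real n * (real n - 1) * (real n - 2) / 6) \<le> ?t n"
      using eventually_ge_at_top[of 6]
    proof eventually_elim
      case (elim n) then show ?case
        unfolding choose3 by (intro divide_right_mono lower) auto
    qed
    show "\<forall>\<^sub>F n in sequentially. ?t n \<le> ((4 / 9 * real n ^ 3 + C * real n ^ 2) / 6) /
            (real n * (real n - 1) * (real n - 2) / 6)"
      using eventually_ge_at_top[of 6]
    proof eventually_elim
      case (elim n) then show ?case
        unfolding choose3 by (intro divide_right_mono upper) auto
    qed
  qed real_asymp+
  then show ?thesis unfolding turan_density_def by (rule limI)
qed

section \<open>Tuples and their reorderings\<close>

definition tuples :: "'v set \<Rightarrow> nat \<Rightarrow> 'v list set" where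
  "tuples V n = {t. set t \<subseteq> V \<and> length t = n}"

lemma finite_tuples: "finite V \<Longrightarrow> finite (tuples V n)"
  unfolding tuples_def by (rule finite_lists_length_eq)

lemma card_tuples: "finite V \<Longrightarrow> card (tuples V n) = card V ^ n"
  unfolding tuples_def by (rule card_lists_length_eq)

lemma sum_tuples_Suc:
  fixes f :: "'v list \<Rightarrow> int"
  shows "(\<Sum>t\<in>tuples V (Suc n). f t) = (\<Sum>x\<in>V. \<Sum>t\<in>tuples V n. f (x # t))"
proof -
  have "bij_betw (\<lambda>p. fst p # snd p) (V \<times> tuples V n) (tuples V (Suc n))"
    by (rule bij_betw_byWitness[where f' = "\<lambda>t. (hd t, tl t)"])
       (auto simp: tuples_def length_Suc_conv)
  then have "(\<Sum>t\<in>tuples V (Suc n). f t) = (\<Sum>(x, t)\<in>V \<times> tuples V n. f (x # t))"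
    by (subst sum.reindex_bij_betw[symmetric]) (auto simp: case_prod_beta)
  then show ?thesis by (simp add: sum.cartesian_product)
qed

lemma tuples_0: "tuples V 0 = {[]}"
  by (auto simp: tuples_def)

definition perms6 :: "nat list set" where
  "perms6 = {p. length p = 6 \<and> distinct p \<and> set p = {..<6}}"

lemma finite_perms6: "finite perms6"
  by (rule finite_subset[OF _ finite_tuples[of "{..<6}" 6]]) (auto simp: perms6_def tuples_def)

lemma perms6_nth: "p \<in> perms6 \<Longrightarrow> i < 6 \<Longrightarrow> p ! i < 6"
  unfolding perms6_def using nth_mem by fastforce

text \<open>Reordering of a tuple by a list of positions. Tuples are lists, so that sums over all six-tuples
  can be unfolded into iterated sums over vertices.\<close>

definition pick :: "'v list \<Rightarrow> nat list \<Rightarrow> 'v list" where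
  "pick t p = map ((!) t) p"

lemma length_pick [simp]: "length (pick t p) = length p"
  by (simp add: pick_def)

lemma pick_nth: "i < length p \<Longrightarrow> pick t p ! i = t ! (p ! i)"
  by (simp add: pick_def)

lemma pick_pick: "\<forall>i\<in>set q. i < length p \<Longrightarrow> pick (pick t p) q = pick t (pick p q)"
  by (auto simp: pick_def)

lemma set_pick: "p \<in> perms6 \<Longrightarrow> length t = 6 \<Longrightarrow> set (pick t p) = set t"
  by (simp add: pick_def perms6_def) (auto simp: set_conv_nth)

lemma pick_tuples: "p \<in> perms6 \<Longrightarrow> t \<in> tuples V 6 \<Longrightarrow> pick t p \<in> tuples V 6"
  using set_pick by (fastforce simp: tuples_def perms6_def)

lemma pick_inj:
  assumes "p \<in> perms6" "length t = 6" "length t' = 6" "pick t p = pick t' p"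
  shows "t = t'"
proof (rule nth_equalityI)
  fix i assume "i < length t"
  then have "i \<in> set p" using assms by (auto simp: perms6_def)
  then show "t ! i = t' ! i" using assms(4) by (auto simp: pick_def)
qed (use assms in auto)

lemma pick_distinct: "p \<in> perms6 \<Longrightarrow> length t = 6 \<Longrightarrow> distinct t \<Longrightarrow> distinct (pick t p)"
  unfolding pick_def perms6_def by (auto simp: distinct_map inj_on_def nth_eq_iff_index_eq)

lemma pick_perms6: "p \<in> perms6 \<Longrightarrow> q \<in> perms6 \<Longrightarrow> pick p q \<in> perms6"
  using set_pick[of q p] pick_distinct[of q p] by (auto simp: perms6_def)

lemma bij_pick_tuples:
  assumes "finite V" "p \<in> perms6"
  shows "bij_betw (\<lambda>t. pick t p) (tuples V 6) (tuples V 6)"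
proof -
  have "inj_on (\<lambda>t. pick t p) (tuples V 6)"
    using pick_inj[OF assms(2)] by (auto simp: inj_on_def tuples_def)
  moreover have "(\<lambda>t. pick t p) ` tuples V 6 \<subseteq> tuples V 6" using pick_tuples[OF assms(2)] by blast
  ultimately show ?thesis using endo_inj_surj[OF finite_tuples[OF assms(1)]] by (simp add: bij_betw_def)
qed

lemma bij_pick_perms6:
  assumes "p \<in> perms6"
  shows "bij_betw (pick p) perms6 perms6"
proof -
  have "inj_on (pick p) perms6"
  proof (rule inj_onI)
    fix q r assume qr: "q \<in> perms6" "r \<in> perms6" "pick p q = pick p r"
    have "inj_on ((!) p) {..<6}" using assms by (auto simp: perms6_def inj_on_def nth_eq_iff_index_eq)
    then show "q = r" using qr unfolding pick_def perms6_def
      by (metis (mono_tags, lifting) inj_on_map_eq_map mem_Collect_eq sup.idem)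
  qed
  moreover have "pick p ` perms6 \<subseteq> perms6" using pick_perms6[OF assms] by blast
  ultimately show ?thesis using endo_inj_surj[OF finite_perms6] by (simp add: bij_betw_def)
qed

text \<open>Averaging: permuting the positions is a bijection of the six-tuples, so each ordering contributes
  the same total.\<close>

lemma sum_tuples_symmetrise:
  fixes f :: "'v list \<Rightarrow> int"
  assumes "finite V"
  shows "(\<Sum>t\<in>tuples V 6. \<Sum>p\<in>perms6. f (pick t p)) = int (card perms6) * (\<Sum>t\<in>tuples V 6. f t)"
proof -
  have "(\<Sum>t\<in>tuples V 6. \<Sum>p\<in>perms6. f (pick t p)) = (\<Sum>p\<in>perms6. \<Sum>t\<in>tuples V 6. f (pick t p))"
    by (rule sum.swap)
  also have "\<dots> = (\<Sum>p\<in>perms6. \<Sum>t\<in>tuples V 6. f t)"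
    by (rule sum.cong[OF refl], rule sum.reindex_bij_betw[OF bij_pick_tuples[OF assms]])
  finally show ?thesis by simp
qed

lemma sum_pick_invariant:
  fixes f :: "'v list \<Rightarrow> int"
  assumes "p \<in> perms6"
  shows "(\<Sum>q\<in>perms6. f (pick (pick t p) q)) = (\<Sum>q\<in>perms6. f (pick t q))"
proof -
  have "pick (pick t p) q = pick t (pick p q)" if "q \<in> perms6" for q
    using that assms by (intro pick_pick) (auto simp: perms6_def)
  then have "(\<Sum>q\<in>perms6. f (pick (pick t p) q)) = (\<Sum>q\<in>perms6. f (pick t (pick p q)))" by simp
  also have "\<dots> = (\<Sum>q\<in>perms6. f (pick t q))"
    by (rule sum.reindex_bij_betw[OF bij_pick_perms6[OF assms]])
  finally show ?thesis .
qed

text \<open>Deleting the determined position is injective. This is the source of every $O(n^5)$ error term.\<close>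

lemma card_determined_coordinate:
  assumes V: "finite V" and A: "A \<subseteq> tuples V 6" and k: "k < 6"
    and det: "\<And>t t'. t \<in> A \<Longrightarrow> t' \<in> A \<Longrightarrow> (\<And>i. i < 6 \<Longrightarrow> i \<noteq> k \<Longrightarrow> t ! i = t' ! i) \<Longrightarrow> t ! k = t' ! k"
  shows "card A \<le> card V ^ 5"
proof -
  let ?f = "\<lambda>t. take k t @ drop (Suc k) t"
  have "inj_on ?f A"
  proof (rule inj_onI)
    fix t t' assume tt: "t \<in> A" "t' \<in> A" and eq: "?f t = ?f t'"
    have len: "length t = 6" "length t' = 6" using tt A by (auto simp: tuples_def)
    have "take k t = take k t'" "drop (Suc k) t = drop (Suc k) t'"
      using eq len k by (auto simp: append_eq_append_conv)
    then have same: "t ! i = t' ! i" if "i < 6" "i \<noteq> k" for i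
      using that len k
      by (metis Suc_leI add_diff_inverse_nat linorder_neqE_nat not_less nth_drop nth_take order_less_imp_le not_less_eq)
    then have "t ! k = t' ! k" using det tt by blast
    then show "t = t'" using same len by (metis nth_equalityI)
  qed
  moreover have "?f ` A \<subseteq> tuples V 5"
    using A k by (fastforce simp: tuples_def dest!: in_set_takeD in_set_dropD)
  ultimately have "card A \<le> card (tuples V 5)" using card_inj_on_le finite_tuples[OF V] by blast
  then show ?thesis by (simp add: card_tuples[OF V])
qed

definition sw :: "nat \<Rightarrow> nat \<Rightarrow> 'v list \<Rightarrow> 'v list" where
  "sw i j p = p[i := p ! j, j := p ! i]"

lemma sw_nth: "length p = 6 \<Longrightarrow> i < 6 \<Longrightarrow> j < 6 \<Longrightarrow> k < 6 \<Longrightarrow>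
   sw i j p ! k = (if k = i then p ! j else if k = j then p ! i else p ! k)"
  by (auto simp: sw_def nth_list_update)

lemma sw_perms6: "p \<in> perms6 \<Longrightarrow> i < 6 \<Longrightarrow> j < 6 \<Longrightarrow> sw i j p \<in> perms6"
  by (auto simp: sw_def perms6_def distinct_swap)

lemma sw_sw: "length p = 6 \<Longrightarrow> i < 6 \<Longrightarrow> j < 6 \<Longrightarrow> sw i j (sw i j p) = p"
  by (rule nth_equalityI) (auto simp: sw_def nth_list_update)

text \<open>An involution that exchanges the elements with and without the property, and keeps the summand,
  pairs off equal contributions.\<close>

lemma sum_involution_halve:
  fixes f :: "nat list \<Rightarrow> int"
  assumes fin: "finite A" and \<tau>: "\<And>p. p \<in> A \<Longrightarrow> \<tau> p \<in> A" "\<And>p. p \<in> A \<Longrightarrow> \<tau> (\<tau> p) = p"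
    and P: "\<And>p. p \<in> A \<Longrightarrow> P (\<tau> p) \<longleftrightarrow> \<not> P p" and f: "\<And>p. p \<in> A \<Longrightarrow> f (\<tau> p) = f p"
  shows "sum f A = 2 * sum f {p\<in>A. P p}"
proof -
  have "sum f A = sum f {p\<in>A. P p} + sum f {p\<in>A. \<not> P p}"
    using fin by (subst sum.union_disjoint[symmetric]) (auto intro: arg_cong[of _ _ "sum f"])
  also have "sum f {p\<in>A. \<not> P p} = sum f {p\<in>A. P p}"
    by (rule sum.reindex_bij_witness[of _ \<tau> \<tau>]) (use \<tau> P f in auto)
  finally show ?thesis by simp
qed

text \<open>A summand symmetric in two positions may be summed over the orderings in which these positions
  increase.\<close>

lemma sum_halve:
  fixes f :: "nat list \<Rightarrow> int"
  assumes A: "A \<subseteq> perms6" "\<And>p. p \<in> A \<Longrightarrow> sw i j p \<in> A" and ij: "i < 6" "j < 6" "i \<noteq> j"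
    and f: "\<And>p. p \<in> A \<Longrightarrow> f (sw i j p) = f p"
  shows "sum f A = 2 * sum f {p\<in>A. p ! i < p ! j}"
proof (rule sum_involution_halve[where \<tau> = "sw i j"])
  have len: "length p = 6" "p ! i \<noteq> p ! j" if "p \<in> A" for p
    using that A(1) ij by (auto simp: perms6_def nth_eq_iff_index_eq)
  show "finite A" using A(1) finite_perms6 finite_subset by blast
  show "sw i j (sw i j p) = p" if "p \<in> A" for p using len that ij by (simp add: sw_sw)
  show "sw i j p ! i < sw i j p ! j \<longleftrightarrow> \<not> p ! i < p ! j" if "p \<in> A" for p
    using len[OF that] ij by (auto simp: sw_nth)
qed (use A f in auto)

text \<open>The corresponding reduction for three positions, applied after two of them are already sorted.\<close>

lemma sum_third:
  fixes f :: "nat list \<Rightarrow> int"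
  assumes A: "A \<subseteq> perms6" "\<And>p. p \<in> A \<Longrightarrow> sw i j p \<in> A" "\<And>p. p \<in> A \<Longrightarrow> sw j k p \<in> A"
    and ijk: "i < 6" "j < 6" "k < 6" "i \<noteq> j" "j \<noteq> k" "i \<noteq> k"
    and f: "\<And>p. p \<in> A \<Longrightarrow> f (sw i j p) = f p" "\<And>p. p \<in> A \<Longrightarrow> f (sw j k p) = f p"
  shows "sum f A = 6 * sum f {p\<in>A. p ! i < p ! j \<and> p ! j < p ! k}"
proof -
  let ?S = "{p\<in>A. p ! i < p ! j \<and> p ! j < p ! k}"
  let ?B = "{p\<in>A. p ! i < p ! k \<and> p ! k < p ! j}"
  let ?C = "{p\<in>A. p ! k < p ! i \<and> p ! i < p ! j}"
  have len: "length p = 6" "p ! i \<noteq> p ! j" "p ! j \<noteq> p ! k" "p ! i \<noteq> p ! k" if "p \<in> A" for p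
    using that A(1) ijk by (auto simp: perms6_def nth_eq_iff_index_eq)
  have fin: "finite A" using A(1) finite_perms6 finite_subset by blast
  have split: "{p\<in>A. p ! i < p ! j} = ?S \<union> (?B \<union> ?C)"
    using len by (auto simp: neq_iff)
  have "sum f {p\<in>A. p ! i < p ! j} = sum f ?S + (sum f ?B + sum f ?C)"
    unfolding split using fin
    by (subst sum.union_disjoint, simp, simp, force, subst sum.union_disjoint, simp, simp, force) simp
  moreover have "sum f ?B = sum f ?S"
    by (rule sum.reindex_bij_witness[of _ "sw j k" "sw j k"])
       (use len ijk A f in \<open>auto simp: sw_sw sw_nth\<close>)
  moreover have "sum f ?C = sum f ?S"
    by (rule sum.reindex_bij_witness[of _ "\<lambda>p. sw j k (sw i j p)" "\<lambda>p. sw i j (sw j k p)"])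
       (use len ijk A f in \<open>auto simp: sw_sw sw_nth\<close>)
  moreover have "sum f A = 2 * sum f {p\<in>A. p ! i < p ! j}"
    by (rule sum_halve) (use A f ijk in auto)
  ultimately show ?thesis by simp
qed

section \<open>The certificate\<close>

text \<open>Up to the choice of arguments this is the weight $1$ or $-2$ that also occurs in
  \<open>star_weight\<close>. It has mean $0$ on the extremal graph and adjusts \<open>L1\<close>
  and \<open>L2\<close> there.\<close>

definition star_test :: "int \<Rightarrow> int \<Rightarrow> int \<Rightarrow> int \<Rightarrow> int \<Rightarrow> int \<Rightarrow> int" where
  "star_test p q a b c d = a*b*c*d*(1-p)*(1-q) - 2*p*(1-a)*(1-b)*(1-c)*(1-d)*(1-q)"

text \<open>A cherry consists of the edges $abc$ and $abd$ on four vertices that span no further edge. For a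
  fifth vertex $y$ the six arguments of the functionals \<open>L1\<close> to \<open>L5\<close> are
  the indicators of $aby, cdy, acy, ady, bcy, bdy$. The coefficients come from rounding the solution
  of the semidefinite program. \<open>L1\<close> and \<open>L2\<close> are invariant under the
  symmetries of the cherry.\<close>

definition L1 :: "int \<Rightarrow> int \<Rightarrow> int \<Rightarrow> int \<Rightarrow> int \<Rightarrow> int \<Rightarrow> int" where
  "L1 p q a b c d = - 20 * star_test p q a b c d - 120*p - 2*(a+b+c+d) + 28*p*(a+b+c+d) + 100*p*q
     + q*(60*(a*b+c*d) - 52*(a*c+b*d) + 60*(a*d+b*c)) + 17*(a*b*c+a*b*d+a*c*d+b*c*d)"

definition L2 :: "int \<Rightarrow> int \<Rightarrow> int \<Rightarrow> int \<Rightarrow> int \<Rightarrow> int \<Rightarrow> int" where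
  "L2 p q a b c d = - 28 * star_test p q a b c d - 56*p + 49*(a+b+c+d) - 16*p*(a+b+c+d) - 60*q*(a+b+c+d) + 32*p*q
     + q*(64*(a*b+c*d+a*c+b*d) - 48*(a*d+b*c)) - 31*(a*b+c*d) - 53*(a*c+b*d)"

text \<open>\<open>L3\<close>, \<open>L4\<close>, \<open>L5\<close> belong to the three sign characters of the
  symmetry group of the cherry: exchanging $c$ and $d$, or $a$ and $b$, changes the sign or not.\<close>

definition L3 :: "int \<Rightarrow> int \<Rightarrow> int \<Rightarrow> int \<Rightarrow> int \<Rightarrow> int \<Rightarrow> int" where
  "L3 p q a b c d = (a+c-b-d)*(4-3*p*q) + (a*c-b*d)*(6*p+3*q)"

definition L4 :: "int \<Rightarrow> int \<Rightarrow> int \<Rightarrow> int \<Rightarrow> int \<Rightarrow> int \<Rightarrow> int" where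
  "L4 p q a b c d = (a-b-c+d)*(3*q-2*p) + (a*d-b*c)*(3-5*p*q)"

definition L5 :: "int \<Rightarrow> int \<Rightarrow> int \<Rightarrow> int \<Rightarrow> int \<Rightarrow> int \<Rightarrow> int" where
  "L5 p q a b c d = (a+b-c-d)*(4-3*p) + 11*q*(a*b-c*d)"

definition vec :: "bool \<Rightarrow> bool \<Rightarrow> bool \<Rightarrow> bool \<Rightarrow> bool \<Rightarrow> bool \<Rightarrow> int \<times> int \<times> int \<times> int \<times> int" where
  "vec p q a b c d = (let f = (\<lambda>L. L (of_bool p) (of_bool q) (of_bool a) (of_bool b) (of_bool c) (of_bool d))
     in (f L1, f L2, f L3, f L4, f L5))"

text \<open>The diagonal entries are the weights of the five squares in the certificate.\<close>

fun dot :: "int \<times> int \<times> int \<times> int \<times> int \<Rightarrow> int \<times> int \<times> int \<times> int \<times> int \<Rightarrow> int" where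
  "dot (a,b,c,d,e) (a',b',c',d',e') = 4*(a*a') + 3*(b*b') + 308*(c*c') + 500*(d*d') + 128*(e*e')"

lemma vec_swap_ends:
  "vec p q c d a b = (case vec p q a b c d of (x1, x2, x3, x4, x5) \<Rightarrow> (x1, x2, x3, - x4, - x5))"
  by (cases p; cases q; cases a; cases b; cases c; cases d)
     (simp_all add: vec_def L1_def L2_def L3_def L4_def L5_def star_test_def)

lemma vec_swap_leaves:
  "vec p q b a d c = (case vec p q a b c d of (x1, x2, x3, x4, x5) \<Rightarrow> (x1, x2, - x3, - x4, x5))"
  by (cases p; cases q; cases a; cases b; cases c; cases d)
     (simp_all add: vec_def L1_def L2_def L3_def L4_def L5_def star_test_def)

lemma dot_neg:
  "dot (case v of (x1, x2, x3, x4, x5) \<Rightarrow> (x1, x2, x3, - x4, - x5))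
       (case w of (x1, x2, x3, x4, x5) \<Rightarrow> (x1, x2, x3, - x4, - x5)) = dot v w"
  "dot (case v of (x1, x2, x3, x4, x5) \<Rightarrow> (x1, x2, - x3, - x4, x5))
       (case w of (x1, x2, x3, x4, x5) \<Rightarrow> (x1, x2, - x3, - x4, x5)) = dot v w"
  by (cases v; cases w; simp)+

lemma dot_swap_ends: "dot (vec p q c d a b) (vec p' q' c' d' a' b') = dot (vec p q a b c d) (vec p' q' a' b' c' d')"
  by (simp only: vec_swap_ends[of p q c d a b] vec_swap_ends[of p' q' c' d' a' b'] dot_neg)
lemma dot_swap_leaves: "dot (vec p q b a d c) (vec p' q' b' a' d' c') = dot (vec p q a b c d) (vec p' q' a' b' c' d')"
  by (simp only: vec_swap_leaves[of p q b a d c] vec_swap_leaves[of p' q' b' a' d' c'] dot_neg)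
lemma dot_commute: "dot v w = dot w v"
  by (cases v; cases w) (simp add: mult.commute)

text \<open>The complete graph on four vertices without one edge, with apex $a$.\<close>

definition K4m :: "('v \<Rightarrow> 'v \<Rightarrow> 'v \<Rightarrow> bool) \<Rightarrow> 'v \<Rightarrow> 'v \<Rightarrow> 'v \<Rightarrow> 'v \<Rightarrow> bool" where
  "K4m e a b c d \<longleftrightarrow> e a b c \<and> e a b d \<and> e a c d \<and> \<not> e b c d"

definition cherry :: "('v \<Rightarrow> 'v \<Rightarrow> 'v \<Rightarrow> bool) \<Rightarrow> 'v \<Rightarrow> 'v \<Rightarrow> 'v \<Rightarrow> 'v \<Rightarrow> bool" where
  "cherry e a b c d \<longleftrightarrow> e a b c \<and> e a b d \<and> \<not> e a c d \<and> \<not> e b c d"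

text \<open>In the extremal graph the apex $a$ lies in $V_1$ and $b, c, d$ lie in $V_0$. A vertex $y$ of
  $V_0$, which has proportion $2/3$, then gets weight $1$, and a vertex of $V_1$ gets weight $-2$,
  so the mean is $0$.\<close>

definition star_weight :: "('v \<Rightarrow> 'v \<Rightarrow> 'v \<Rightarrow> bool) \<Rightarrow> 'v \<Rightarrow> 'v \<Rightarrow> 'v \<Rightarrow> 'v \<Rightarrow> 'v \<Rightarrow> int" where
  "star_weight e a b c d y =
     of_bool (e a b y \<and> e a c y \<and> e a d y \<and> \<not> e b c y \<and> \<not> e b d y \<and> \<not> e c d y)
     - 2 * of_bool (\<not> e a b y \<and> \<not> e a c y \<and> \<not> e a d y \<and> e b c y \<and> e b d y \<and> e c d y)"

definition cherry_form :: "('v \<Rightarrow> 'v \<Rightarrow> 'v \<Rightarrow> bool) \<Rightarrow> 'v \<Rightarrow> 'v \<Rightarrow> 'v \<Rightarrow> 'v \<Rightarrow> 'v \<Rightarrow> 'v \<Rightarrow> int" where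
  "cherry_form e a b c d y z =
     dot (vec (e a b y) (e c d y) (e a c y) (e a d y) (e b c y) (e b d y))
         (vec (e a b z) (e c d z) (e a c z) (e a d z) (e b c z) (e b d z))"

text \<open>The summands of the certificate are functions of six-tuples: the first four or five positions
  carry the configuration, and for the squares the last two positions carry the two independent
  vertices.\<close>

definition pair_term :: "('v \<Rightarrow> 'v \<Rightarrow> 'v \<Rightarrow> bool) \<Rightarrow> 'v list \<Rightarrow> int" where
  "pair_term e t = (if e (t!0) (t!1) (t!2) then if e (t!0) (t!3) (t!4) then 1 else 0 else 0)"

definition edge_term :: "('v \<Rightarrow> 'v \<Rightarrow> 'v \<Rightarrow> bool) \<Rightarrow> 'v list \<Rightarrow> int" where
  "edge_term e t = (if e (t!0) (t!1) (t!2) then 1 else 0)"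

definition K4m_term :: "('v \<Rightarrow> 'v \<Rightarrow> 'v \<Rightarrow> bool) \<Rightarrow> 'v list \<Rightarrow> int" where
  "K4m_term e t = (if K4m e (t!0) (t!1) (t!2) (t!3)
     then star_weight e (t!0) (t!1) (t!2) (t!3) (t!4) * star_weight e (t!0) (t!1) (t!2) (t!3) (t!5) else 0)"

definition cherry_term :: "('v \<Rightarrow> 'v \<Rightarrow> 'v \<Rightarrow> bool) \<Rightarrow> 'v list \<Rightarrow> int" where
  "cherry_term e t = (if cherry e (t!0) (t!1) (t!2) (t!3)
     then cherry_form e (t!0) (t!1) (t!2) (t!3) (t!4) (t!5) else 0)"

text \<open>Each ordering of a six-set carries the terms with multiplicity $8$, $36$, $12$ and $8$; the
  weights are chosen so that the sum over the orderings is $12$ times the integer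
  \<open>six_value\<close>.\<close>

definition local_term :: "('v \<Rightarrow> 'v \<Rightarrow> 'v \<Rightarrow> bool) \<Rightarrow> 'v list \<Rightarrow> int" where
  "local_term e t = 6400 * (9 * pair_term e t - 4 * edge_term e t) + 19200 * K4m_term e t + 3 * cherry_term e t"

text \<open>An explicit list of the orderings, so that representatives of the orbits can be computed.\<close>

primrec arrangements :: "nat \<Rightarrow> 'a list \<Rightarrow> 'a list list" where
  "arrangements 0 xs = [[]]"
| "arrangements (Suc n) xs = concat (map (\<lambda>x. map ((#) x) (arrangements n (remove1 x xs))) xs)"

definition perm_list :: "nat list list" where
  "perm_list = arrangements 6 [0..<6]"

definition "pair_list = filter (\<lambda>p. p!1 < p!2 \<and> p!3 < p!4 \<and> p!1 < p!3) perm_list"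
definition "edge_list = filter (\<lambda>p. (p!0 < p!1 \<and> p!1 < p!2) \<and> (p!3 < p!4 \<and> p!4 < p!5)) perm_list"
definition "K4m_list = filter (\<lambda>p. (p!1 < p!2 \<and> p!2 < p!3) \<and> p!4 < p!5) perm_list"
definition "cherry_list = filter (\<lambda>p. p!0 < p!1 \<and> p!2 < p!3 \<and> p!4 < p!5) perm_list"

lemma perms6_alt: "perms6 = {p. length p = 6 \<and> distinct p \<and> set p \<subseteq> {..<6}}"
proof -
  have "set p = {..<6}" if "length p = 6" "distinct p" "set p \<subseteq> {..<6}" for p :: "nat list"
    using that by (intro card_subset_eq) (auto simp: distinct_card)
  then show ?thesis by (auto simp: perms6_def)
qed

lemma set_arrangements:
  "distinct xs \<Longrightarrow> set (arrangements n xs) = {p. length p = n \<and> distinct p \<and> set p \<subseteq> set xs}"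
proof (induction n arbitrary: xs)
  case (Suc n)
  have "set (arrangements (Suc n) xs) = (\<Union>x\<in>set xs. (#) x ` {p. length p = n \<and> distinct p \<and> set p \<subseteq> set xs - {x}})"
    using Suc by simp
  also have "\<dots> = {p. length p = Suc n \<and> distinct p \<and> set p \<subseteq> set xs}"
    by (auto simp: length_Suc_conv image_iff)
  finally show ?case .
qed auto

lemma distinct_arrangements: "distinct xs \<Longrightarrow> distinct (arrangements n xs)"
proof (induction n arbitrary: xs)
  case (Suc n)
  have "distinct (concat (map (\<lambda>x. map ((#) x) (arrangements n (remove1 x xs))) ys))"
    if "distinct ys" "set ys \<subseteq> set xs" for ys
    using that Suc by (induction ys) (auto simp: distinct_map)
  then show ?case using Suc.prems by simp
qed simp

lemma set_perm_list: "set perm_list = perms6"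
  unfolding perm_list_def perms6_alt by (subst set_arrangements) (auto simp: atLeast0LessThan)

lemma distinct_perm_list: "distinct perm_list"
  unfolding perm_list_def by (rule distinct_arrangements) simp

lemma set_pair_list: "set pair_list = {p\<in>perms6. p!1 < p!2 \<and> p!3 < p!4 \<and> p!1 < p!3}"
  and set_edge_list: "set edge_list = {p\<in>perms6. (p!0 < p!1 \<and> p!1 < p!2) \<and> (p!3 < p!4 \<and> p!4 < p!5)}"
  and set_K4m_list: "set K4m_list = {p\<in>perms6. (p!1 < p!2 \<and> p!2 < p!3) \<and> p!4 < p!5}"
  and set_cherry_list: "set cherry_list = {p\<in>perms6. p!0 < p!1 \<and> p!2 < p!3 \<and> p!4 < p!5}"
  by (simp_all add: pair_list_def edge_list_def K4m_list_def cherry_list_def set_perm_list)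

lemma distinct_lists: "distinct pair_list" "distinct edge_list" "distinct K4m_list" "distinct cherry_list"
  by (simp_all add: pair_list_def edge_list_def K4m_list_def cherry_list_def distinct_perm_list)

text \<open>Invariance under two adjacent transpositions, which generate all permutations of the three
  arguments.\<close>

definition symmetric3 :: "('v \<Rightarrow> 'v \<Rightarrow> 'v \<Rightarrow> bool) \<Rightarrow> bool" where
  "symmetric3 e \<longleftrightarrow> (\<forall>a b c. e a b c = e b a c \<and> e a b c = e a c b)"

context
  fixes e :: "'v \<Rightarrow> 'v \<Rightarrow> 'v \<Rightarrow> bool"
  assumes sym: "symmetric3 e"
begin

lemma sym12: "e a b c = e b a c" and sym23: "e a b c = e a c b"
  using sym unfolding symmetric3_def by blast+

lemma pick_sw: "p \<in> perms6 \<Longrightarrow> i < 6 \<Longrightarrow> j < 6 \<Longrightarrow> k < 6 \<Longrightarrow>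
  pick t (sw i j p) ! k = (if k = i then pick t p ! j else if k = j then pick t p ! i else pick t p ! k)"
  by (auto simp: pick_def perms6_def sw_def nth_list_update)

lemma sw_nth6: "p \<in> perms6 \<Longrightarrow> i < 6 \<Longrightarrow> j < 6 \<Longrightarrow> k < 6 \<Longrightarrow>
   sw i j p ! k = (if k = i then p ! j else if k = j then p ! i else p ! k)"
  by (rule sw_nth) (auto simp: perms6_def)

lemma sum_pair_term: "(\<Sum>p\<in>perms6. pair_term e (pick t p)) = 8 * (\<Sum>p\<leftarrow>pair_list. pair_term e (pick t p))"
proof -
  let ?f = "\<lambda>p. pair_term e (pick t p)"
  let ?A1 = "{p\<in>perms6. p!1 < p!2}" and ?A2 = "{p\<in>{p\<in>perms6. p!1 < p!2}. p!3 < p!4}"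
  have "sum ?f perms6 = 2 * sum ?f ?A1"
    by (rule sum_halve) (auto simp: sw_perms6 pair_term_def pick_sw sym23)
  also have "sum ?f ?A1 = 2 * sum ?f ?A2"
    by (rule sum_halve) (auto simp: sw_perms6 pair_term_def pick_sw sw_nth6 sym23)
  also have "sum ?f ?A2 = 2 * sum ?f {p\<in>?A2. p!1 < p!3}"
  proof (rule sum_involution_halve[where \<tau> = "\<lambda>p. sw 2 4 (sw 1 3 p)"])
    fix p assume p: "p \<in> ?A2"
    define q where "q = sw 2 4 (sw 1 3 p)"
    have len: "length p = 6" and mem: "sw 1 3 p \<in> perms6" and ne: "p!1 \<noteq> p!3"
      using p by (auto simp: perms6_def nth_eq_iff_index_eq sw_def distinct_swap)
    have len': "length (sw 1 3 p) = 6" and lenq: "length q = 6" by (simp_all add: sw_def len q_def)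
    have nth: "q ! k = (if k = 1 then p!3 else if k = 3 then p!1 else if k = 2 then p!4
        else if k = 4 then p!2 else p!k)" if "k < 6" for k
      unfolding q_def using that len len' by (simp add: sw_nth)
    have "q \<in> perms6" unfolding q_def using mem by (simp add: sw_perms6)
    then show "sw 2 4 (sw 1 3 p) \<in> ?A2" unfolding q_def[symmetric] using p by (simp add: nth)
    show "sw 2 4 (sw 1 3 (sw 2 4 (sw 1 3 p))) = p"
      using len by (intro nth_equalityI) (auto simp: sw_def nth_list_update)
    show "sw 2 4 (sw 1 3 p) ! 1 < sw 2 4 (sw 1 3 p) ! 3 \<longleftrightarrow> \<not> p ! 1 < p ! 3"
      unfolding q_def[symmetric] using ne by (auto simp: nth)
    show "?f (sw 2 4 (sw 1 3 p)) = ?f p"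
      unfolding q_def[symmetric] using len lenq by (simp add: pair_term_def pick_nth nth)
  qed (simp add: finite_perms6)
  also have "{p\<in>?A2. p!1 < p!3} = set pair_list" by (auto simp: set_pair_list)
  finally show ?thesis by (simp add: sum.distinct_set_conv_list distinct_lists)
qed

lemma sum_edge_term: "(\<Sum>p\<in>perms6. edge_term e (pick t p)) = 36 * (\<Sum>p\<leftarrow>edge_list. edge_term e (pick t p))"
proof -
  let ?f = "\<lambda>p. edge_term e (pick t p)"
  let ?A1 = "{p\<in>perms6. p!0 < p!1 \<and> p!1 < p!2}"
  have "e (pick t p ! 0) (pick t p ! 2) (pick t p ! Suc 0) = e (pick t p ! 0) (pick t p ! Suc 0) (pick t p ! 2)"
     "e (pick t p ! Suc 0) (pick t p ! 0) (pick t p ! 2) = e (pick t p ! 0) (pick t p ! Suc 0) (pick t p ! 2)" for p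
    using sym12 sym23 by blast+
  then have "sum ?f perms6 = 6 * sum ?f ?A1"
    by (intro sum_third) (auto simp: sw_perms6 edge_term_def pick_sw)
  also have "sum ?f ?A1 = 6 * sum ?f {p\<in>?A1. p!3 < p!4 \<and> p!4 < p!5}"
    by (rule sum_third) (auto simp: sw_perms6 edge_term_def pick_sw sw_nth6)
  also have "{p\<in>?A1. p!3 < p!4 \<and> p!4 < p!5} = set edge_list" by (auto simp: set_edge_list)
  finally show ?thesis by (simp add: sum.distinct_set_conv_list distinct_lists)
qed

lemma star_weight_swaps:
  "star_weight e a c b d y = star_weight e a b c d y" "star_weight e a b d c y = star_weight e a b c d y"
  unfolding star_weight_def using sym12 sym23 by (smt (verit))+

lemma K4m_swaps: "K4m e a c b d = K4m e a b c d" "K4m e a b d c = K4m e a b c d"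
  unfolding K4m_def using sym12 sym23 by (smt (verit))+

lemma sum_K4m_term: "(\<Sum>p\<in>perms6. K4m_term e (pick t p)) = 12 * (\<Sum>p\<leftarrow>K4m_list. K4m_term e (pick t p))"
proof -
  let ?f = "\<lambda>p. K4m_term e (pick t p)"
  let ?A1 = "{p\<in>perms6. p!1 < p!2 \<and> p!2 < p!3}"
  have "sum ?f perms6 = 6 * sum ?f ?A1"
    by (rule sum_third) (auto simp: sw_perms6 K4m_term_def pick_sw star_weight_swaps K4m_swaps)
  also have "sum ?f ?A1 = 2 * sum ?f {p\<in>?A1. p!4 < p!5}"
    by (rule sum_halve) (auto simp: sw_perms6 K4m_term_def pick_sw sw_nth6 mult.commute)
  also have "{p\<in>?A1. p!4 < p!5} = set K4m_list" by (auto simp: set_K4m_list)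
  finally show ?thesis by (simp add: sum.distinct_set_conv_list distinct_lists)
qed

lemma cherry_swaps: "cherry e b a c d = cherry e a b c d" "cherry e a b d c = cherry e a b c d"
  unfolding cherry_def using sym12 sym23 by (smt (verit))+

lemma cherry_form_swaps:
  "cherry_form e b a c d y z = cherry_form e a b c d y z"
  "cherry_form e a b d c y z = cherry_form e a b c d y z"
  "cherry_form e a b c d z y = cherry_form e a b c d y z"
proof -
  show "cherry_form e b a c d y z = cherry_form e a b c d y z"
    unfolding cherry_form_def sym12[of b a] by (rule dot_swap_ends)
  show "cherry_form e a b d c y z = cherry_form e a b c d y z"
    unfolding cherry_form_def sym12[of d c] by (rule dot_swap_leaves)
  show "cherry_form e a b c d z y = cherry_form e a b c d y z"
    unfolding cherry_form_def by (rule dot_commute)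
qed

lemma sum_cherry_term: "(\<Sum>p\<in>perms6. cherry_term e (pick t p)) = 8 * (\<Sum>p\<leftarrow>cherry_list. cherry_term e (pick t p))"
proof -
  let ?f = "\<lambda>p. cherry_term e (pick t p)"
  let ?A1 = "{p\<in>perms6. p!0 < p!1}" and ?A2 = "{p\<in>{p\<in>perms6. p!0 < p!1}. p!2 < p!3}"
  have "sum ?f perms6 = 2 * sum ?f ?A1"
    by (rule sum_halve) (auto simp: sw_perms6 cherry_term_def pick_sw cherry_swaps cherry_form_swaps)
  also have "sum ?f ?A1 = 2 * sum ?f ?A2"
    by (rule sum_halve) (auto simp: sw_perms6 cherry_term_def pick_sw cherry_swaps cherry_form_swaps sw_nth6)
  also have "sum ?f ?A2 = 2 * sum ?f {p\<in>?A2. p!4 < p!5}"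
    by (rule sum_halve) (auto simp: sw_perms6 cherry_term_def pick_sw cherry_swaps sw_nth6 cherry_form_swaps(3))
  also have "{p\<in>?A2. p!4 < p!5} = set cherry_list" by (auto simp: set_cherry_list)
  finally show ?thesis by (simp add: sum.distinct_set_conv_list distinct_lists)
qed

end

text \<open>Each of the four sums runs over one representative ordering of each configuration on six vertices.\<close>

definition six_value :: "(nat \<Rightarrow> nat \<Rightarrow> nat \<Rightarrow> bool) \<Rightarrow> int" where
  "six_value g = 38400 * ((\<Sum>p\<leftarrow>pair_list. pair_term g p) - 2 * (\<Sum>p\<leftarrow>edge_list. edge_term g p))
     + 19200 * (\<Sum>p\<leftarrow>K4m_list. K4m_term g p) + 2 * (\<Sum>p\<leftarrow>cherry_list. cherry_term g p)"

section \<open>Encoding of six-vertex graphs\<close>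

text \<open>The position of a triple in the colexicographic order. Triples without the vertex $5$ come first,
  so a graph on five vertices is a prefix of the encoding.\<close>

definition tri :: "nat \<Rightarrow> nat \<Rightarrow> nat \<Rightarrow> nat" where
  "tri i j k = (let hi = max i (max j k); lo = min i (min j k); mid = i + j + k - hi - lo
     in (hi choose 3) + (mid choose 2) + lo)"

text \<open>Triples with a repeated entry get some junk value; it is never read.\<close>

definition gr :: "bool list \<Rightarrow> nat \<Rightarrow> nat \<Rightarrow> nat \<Rightarrow> bool" where
  "gr B i j k = B ! tri i j k"

definition triples5 :: "(nat \<times> nat \<times> nat) list" where
  "triples5 = [(0,1,2),(0,1,3),(0,2,3),(1,2,3),(0,1,4),(0,2,4),(1,2,4),(0,3,4),(1,3,4),(2,3,4)]"

definition triples6 :: "(nat \<times> nat \<times> nat) list" where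
  "triples6 = [(0,1,5),(0,2,5),(1,2,5),(0,3,5),(1,3,5),(2,3,5),(0,4,5),(1,4,5),(2,4,5),(3,4,5)]"

definition bits :: "(nat \<times> nat \<times> nat) list \<Rightarrow> (nat \<Rightarrow> nat \<Rightarrow> nat \<Rightarrow> bool) \<Rightarrow> bool list" where
  "bits ts g = map (\<lambda>(i, j, k). g i j k) ts"

text \<open>The transposition of $i$ and $j$, used to exchange two vertices of a graph.\<close>

definition tr :: "nat \<Rightarrow> nat \<Rightarrow> nat \<Rightarrow> nat" where
  "tr i j x = (if x = i then j else if x = j then i else x)"

definition swg :: "nat \<Rightarrow> nat \<Rightarrow> (nat \<Rightarrow> nat \<Rightarrow> nat \<Rightarrow> bool) \<Rightarrow> nat \<Rightarrow> nat \<Rightarrow> nat \<Rightarrow> bool" where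
  "swg i j g a b c = g (tr i j a) (tr i j b) (tr i j c)"

text \<open>The conditionals are nested rather than joined by connectives, here and in the definitions below:
  a conditional can be evaluated without touching the branch that is not taken.\<close>

fun lexle :: "bool list \<Rightarrow> bool list \<Rightarrow> bool" where
  "lexle (x # xs) (y # ys) = (if x then if y then lexle xs ys else False else if y then True else lexle xs ys)"
| "lexle _ _ = True"

text \<open>Compares the numbers of true entries without arithmetic.\<close>

fun count_le :: "bool list \<Rightarrow> bool list \<Rightarrow> bool" where
  "count_le [] ys = True"
| "count_le (x # xs) [] = (if x then False else count_le xs [])"
| "count_le (x # xs) (y # ys) = (if x then if y then count_le xs ys else count_le (x # xs) ys else count_le xs (y # ys))"

text \<open>The adjacent transpositions are tried first, because they fail most often.\<close>

definition transp5 :: "(nat \<times> nat) list" where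
  "transp5 = [(0,1),(1,2),(2,3),(3,4),(0,2),(1,3),(2,4),(0,3),(1,4),(0,4)]"

definition pad :: "bool list \<Rightarrow> bool list" where
  "pad xs = xs @ [False,False,False,False,False,False,False,False,False,False]"

primrec each :: "('a \<Rightarrow> bool) \<Rightarrow> 'a list \<Rightarrow> bool" where
  "each P [] = True"
| "each P (x # xs) = (if P x then each P xs else False)"

lemma each_iff: "each P xs \<longleftrightarrow> (\<forall>x\<in>set xs. P x)"
  by (induction xs) auto

text \<open>The transpositions alone do not single out one representative of an isomorphism class, but they
  leave few enough.\<close>

definition canonical5 :: "bool list \<Rightarrow> bool" where
  "canonical5 xs \<longleftrightarrow> each (\<lambda>(i, j). lexle (bits triples5 (swg i j (gr (pad xs)))) xs) transp5"

definition canonical6 :: "bool list \<Rightarrow> bool" where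
  "canonical6 B \<longleftrightarrow> each (\<lambda>(i, j). lexle (bits (triples5 @ triples6) (swg i j (gr B))) B) transp5"

text \<open>Exchanging the vertices $i$ and $5$ keeps the triples that contain both. The degrees of these two
  vertices are therefore compared through the triples that contain exactly one of them.\<close>

definition link_without :: "nat \<Rightarrow> (nat \<times> nat \<times> nat) list" where
  "link_without i = filter (\<lambda>(a, b, c). a \<noteq> i \<and> b \<noteq> i) triples6"

definition triples_at :: "nat \<Rightarrow> (nat \<times> nat \<times> nat) list" where
  "triples_at i = filter (\<lambda>(a, b, c). a = i \<or> b = i \<or> c = i) triples5"

text \<open>The vertex $5$ has the smallest degree; this cuts the number of links of the last vertex that must
  be considered.\<close>

definition last_minimal :: "(nat \<Rightarrow> nat \<Rightarrow> nat \<Rightarrow> bool) \<Rightarrow> bool" where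
  "last_minimal g \<longleftrightarrow> each (\<lambda>i. count_le (bits (link_without i) g) (bits (triples_at i) g)) [0,1,2,3,4]"

text \<open>The common homomorphic image of \<open>G1\<close> and \<open>G2\<close>.\<close>

definition F_at :: "('v \<Rightarrow> 'v \<Rightarrow> 'v \<Rightarrow> bool) \<Rightarrow> 'v \<Rightarrow> 'v \<Rightarrow> 'v \<Rightarrow> 'v \<Rightarrow> 'v \<Rightarrow> bool" where
  "F_at e v x a b y \<longleftrightarrow> e x a b \<and> e v x a \<and> e v x b \<and> e v x y \<and> e v y a \<and> e v y b"

text \<open>Splitting $v$ in \<open>F_at\<close> into $v$ and $w$, where $w$ takes over the edge $vxy$, gives
  \<open>G1\<close>.\<close>

definition G1_at :: "('v \<Rightarrow> 'v \<Rightarrow> 'v \<Rightarrow> bool) \<Rightarrow> 'v \<Rightarrow> 'v \<Rightarrow> 'v \<Rightarrow> 'v \<Rightarrow> 'v \<Rightarrow> 'v \<Rightarrow> bool" where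
  "G1_at e v w x a b y \<longleftrightarrow> e x a b \<and> e v x a \<and> e v x b \<and> e w x y \<and> e v y a \<and> e v y b"

text \<open>Here $w$ takes over the edges $vxb$ and $vya$.\<close>

definition G2_at :: "('v \<Rightarrow> 'v \<Rightarrow> 'v \<Rightarrow> bool) \<Rightarrow> 'v \<Rightarrow> 'v \<Rightarrow> 'v \<Rightarrow> 'v \<Rightarrow> 'v \<Rightarrow> 'v \<Rightarrow> bool" where
  "G2_at e v w x a b y \<longleftrightarrow> e x a b \<and> e v x a \<and> e w x b \<and> e v x y \<and> e w y a \<and> e v y b"

definition some_other :: "nat \<Rightarrow> nat list \<Rightarrow> (nat \<Rightarrow> bool) \<Rightarrow> bool" where
  "some_other n used P \<longleftrightarrow> list_ex P (filter (\<lambda>i. i \<notin> set used) (take n [0,1,2,3,4,5]))"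

text \<open>The search fixes the edge $xab$ first and prunes at every missing edge.\<close>

definition has_F :: "nat \<Rightarrow> (nat \<Rightarrow> nat \<Rightarrow> nat \<Rightarrow> bool) \<Rightarrow> bool" where
  "has_F n g \<longleftrightarrow> some_other n [] (\<lambda>x. some_other n [x] (\<lambda>a. some_other n [x,a] (\<lambda>b. if g x a b then
     some_other n [x,a,b] (\<lambda>v. if g v x a then if g v x b then some_other n [x,a,b,v] (\<lambda>y.
       if g v x y then if g v y a then g v y b else False else False) else False else False) else False)))"

definition has_G1 :: "(nat \<Rightarrow> nat \<Rightarrow> nat \<Rightarrow> bool) \<Rightarrow> bool" where
  "has_G1 g \<longleftrightarrow> some_other 6 [] (\<lambda>x. some_other 6 [x] (\<lambda>a. some_other 6 [x,a] (\<lambda>b. if g x a b then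
     some_other 6 [x,a,b] (\<lambda>v. if g v x a then if g v x b then some_other 6 [x,a,b,v] (\<lambda>y.
       if g v y a then if g v y b then some_other 6 [x,a,b,v,y] (\<lambda>w. g w x y) else False else False) else False else False) else False)))"

definition has_G2 :: "(nat \<Rightarrow> nat \<Rightarrow> nat \<Rightarrow> bool) \<Rightarrow> bool" where
  "has_G2 g \<longleftrightarrow> some_other 6 [] (\<lambda>x. some_other 6 [x] (\<lambda>a. some_other 6 [x,a] (\<lambda>b. if g x a b then
     some_other 6 [x,a,b] (\<lambda>v. if g v x a then some_other 6 [x,a,b,v] (\<lambda>y.
       if g v x y then if g v y b then some_other 6 [x,a,b,v,y] (\<lambda>w. if g w x b then g w y a else False) else False else False) else False) else False)))"

primrec all_bits :: "nat \<Rightarrow> (bool list \<Rightarrow> bool) \<Rightarrow> bool" where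
  "all_bits 0 P = P []"
| "all_bits (Suc n) P = (if all_bits n (\<lambda>xs. P (True # xs)) then all_bits n (\<lambda>xs. P (False # xs)) else False)"

lemma all_bits_iff: "all_bits n P \<longleftrightarrow> (\<forall>xs. length xs = n \<longrightarrow> P xs)"
proof (induction n arbitrary: P)
  case (Suc n)
  have "(\<forall>xs. length xs = Suc n \<longrightarrow> P xs) \<longleftrightarrow> (\<forall>b xs. length xs = n \<longrightarrow> P (b # xs))"
    by (metis Suc_length_conv)
  then show ?case using Suc by (auto simp: all_bool_eq)
qed simp

text \<open>What has to be shown for a six-vertex graph. Graphs that contain \<open>F\<close>, or both
  \<open>G1\<close> and \<open>G2\<close>, are excluded by the hypotheses.\<close>

definition settled :: "bool list \<Rightarrow> bool" where
  "settled B \<longleftrightarrow> (if six_value (gr B) \<le> 0 then True else if has_F 6 (gr B) then True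
     else if has_G1 (gr B) then has_G2 (gr B) else False)"

definition leaf_settled :: "bool list \<Rightarrow> bool list \<Rightarrow> bool" where
  "leaf_settled xs ys \<longleftrightarrow> (if last_minimal (gr (xs @ ys)) then if canonical6 (xs @ ys) then settled (xs @ ys) else True else True)"

text \<open>All ten triples on the first five vertices are fixed at the root of a search tree, whose leaves
  are the links of the last vertex. A five-vertex graph that contains \<open>F\<close> needs no
  leaves.\<close>

definition root_settled :: "bool list \<Rightarrow> bool" where
  "root_settled xs \<longleftrightarrow> (if canonical5 xs then if has_F 5 (gr (pad xs)) then True else all_bits 10 (leaf_settled xs) else True)"

lemma choose_small: "Suc 0 choose 2 = 0" "Suc (Suc 0) choose 2 = 1" "Suc (Suc 0) choose 3 = 0" "Suc 0 choose 3 = 0" "2 choose 2 = (1::nat)" "3 choose 2 = (3::nat)" "4 choose 2 = (6::nat)"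
   "2 choose 3 = (0::nat)" "3 choose 3 = (1::nat)" "4 choose 3 = (4::nat)" "5 choose 3 = (10::nat)"
  by (simp_all add: numeral_eq_Suc)

lemma tri_swaps: "tri i j k = tri j i k" "tri i j k = tri i k j"
  unfolding tri_def by (simp_all add: Let_def max.commute max.left_commute min.commute min.left_commute add_ac)

lemma gr_swaps: "j < i \<Longrightarrow> gr B i j k = gr B j i k" "k < j \<Longrightarrow> gr B i j k = gr B i k j"
  unfolding gr_def by (metis tri_swaps(1), metis tri_swaps(2))

lemma gr_table:
  "gr [b0, b1, b2, b3, b4, b5, b6, b7, b8, b9, b10, b11, b12, b13, b14, b15, b16, b17, b18, b19] 0 (Suc 0) 2 = b0"
  "gr [b0, b1, b2, b3, b4, b5, b6, b7, b8, b9, b10, b11, b12, b13, b14, b15, b16, b17, b18, b19] 0 (Suc 0) 3 = b1"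
  "gr [b0, b1, b2, b3, b4, b5, b6, b7, b8, b9, b10, b11, b12, b13, b14, b15, b16, b17, b18, b19] 0 2 3 = b2"
  "gr [b0, b1, b2, b3, b4, b5, b6, b7, b8, b9, b10, b11, b12, b13, b14, b15, b16, b17, b18, b19] (Suc 0) 2 3 = b3"
  "gr [b0, b1, b2, b3, b4, b5, b6, b7, b8, b9, b10, b11, b12, b13, b14, b15, b16, b17, b18, b19] 0 (Suc 0) 4 = b4"
  "gr [b0, b1, b2, b3, b4, b5, b6, b7, b8, b9, b10, b11, b12, b13, b14, b15, b16, b17, b18, b19] 0 2 4 = b5"
  "gr [b0, b1, b2, b3, b4, b5, b6, b7, b8, b9, b10, b11, b12, b13, b14, b15, b16, b17, b18, b19] (Suc 0) 2 4 = b6"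
  "gr [b0, b1, b2, b3, b4, b5, b6, b7, b8, b9, b10, b11, b12, b13, b14, b15, b16, b17, b18, b19] 0 3 4 = b7"
  "gr [b0, b1, b2, b3, b4, b5, b6, b7, b8, b9, b10, b11, b12, b13, b14, b15, b16, b17, b18, b19] (Suc 0) 3 4 = b8"
  "gr [b0, b1, b2, b3, b4, b5, b6, b7, b8, b9, b10, b11, b12, b13, b14, b15, b16, b17, b18, b19] 2 3 4 = b9"
  "gr [b0, b1, b2, b3, b4, b5, b6, b7, b8, b9, b10, b11, b12, b13, b14, b15, b16, b17, b18, b19] 0 (Suc 0) 5 = b10"
  "gr [b0, b1, b2, b3, b4, b5, b6, b7, b8, b9, b10, b11, b12, b13, b14, b15, b16, b17, b18, b19] 0 2 5 = b11"
  "gr [b0, b1, b2, b3, b4, b5, b6, b7, b8, b9, b10, b11, b12, b13, b14, b15, b16, b17, b18, b19] (Suc 0) 2 5 = b12"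
  "gr [b0, b1, b2, b3, b4, b5, b6, b7, b8, b9, b10, b11, b12, b13, b14, b15, b16, b17, b18, b19] 0 3 5 = b13"
  "gr [b0, b1, b2, b3, b4, b5, b6, b7, b8, b9, b10, b11, b12, b13, b14, b15, b16, b17, b18, b19] (Suc 0) 3 5 = b14"
  "gr [b0, b1, b2, b3, b4, b5, b6, b7, b8, b9, b10, b11, b12, b13, b14, b15, b16, b17, b18, b19] 2 3 5 = b15"
  "gr [b0, b1, b2, b3, b4, b5, b6, b7, b8, b9, b10, b11, b12, b13, b14, b15, b16, b17, b18, b19] 0 4 5 = b16"
  "gr [b0, b1, b2, b3, b4, b5, b6, b7, b8, b9, b10, b11, b12, b13, b14, b15, b16, b17, b18, b19] (Suc 0) 4 5 = b17"
  "gr [b0, b1, b2, b3, b4, b5, b6, b7, b8, b9, b10, b11, b12, b13, b14, b15, b16, b17, b18, b19] 2 4 5 = b18"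
  "gr [b0, b1, b2, b3, b4, b5, b6, b7, b8, b9, b10, b11, b12, b13, b14, b15, b16, b17, b18, b19] 3 4 5 = b19"
  by (simp_all add: gr_def tri_def Let_def choose_small)

lemmas graph_rules = gr_swaps gr_table pad_def

text \<open>The tests are specialised to a graph with free Boolean entries once, so that the later evaluation
  involves no indices. The congruence rule for conditionals is switched off here, because both
  branches must be simplified.\<close>

schematic_goal canonical5_unfold: "canonical5 [b0, b1, b2, b3, b4, b5, b6, b7, b8, b9] = ?R"
  unfolding canonical5_def transp5_def triples5_def bits_def swg_def tr_def
  by (simp add: graph_rules del: lexle.simps cong del: if_weak_cong split del: if_split)

schematic_goal has_F5_unfold: "has_F 5 (gr (pad [b0, b1, b2, b3, b4, b5, b6, b7, b8, b9])) = ?R"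
  unfolding has_F_def some_other_def by (simp add: graph_rules cong del: if_weak_cong split del: if_split)

schematic_goal last_minimal_unfold: "last_minimal (gr [b0, b1, b2, b3, b4, b5, b6, b7, b8, b9, b10, b11, b12, b13, b14, b15, b16, b17, b18, b19]) = ?R"
  unfolding last_minimal_def link_without_def triples_at_def triples5_def triples6_def bits_def
  by (simp add: graph_rules del: count_le.simps cong del: if_weak_cong split del: if_split)

schematic_goal canonical6_unfold: "canonical6 [b0, b1, b2, b3, b4, b5, b6, b7, b8, b9, b10, b11, b12, b13, b14, b15, b16, b17, b18, b19] = ?R"
  unfolding canonical6_def transp5_def triples5_def triples6_def bits_def swg_def tr_def
  by (simp add: graph_rules del: lexle.simps cong del: if_weak_cong split del: if_split)

schematic_goal has_F6_unfold: "has_F 6 (gr [b0, b1, b2, b3, b4, b5, b6, b7, b8, b9, b10, b11, b12, b13, b14, b15, b16, b17, b18, b19]) = ?R"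
  unfolding has_F_def some_other_def by (simp add: graph_rules cong del: if_weak_cong split del: if_split)

schematic_goal has_G1_unfold: "has_G1 (gr [b0, b1, b2, b3, b4, b5, b6, b7, b8, b9, b10, b11, b12, b13, b14, b15, b16, b17, b18, b19]) = ?R"
  unfolding has_G1_def some_other_def by (simp add: graph_rules cong del: if_weak_cong split del: if_split)

schematic_goal has_G2_unfold: "has_G2 (gr [b0, b1, b2, b3, b4, b5, b6, b7, b8, b9, b10, b11, b12, b13, b14, b15, b16, b17, b18, b19]) = ?R"
  unfolding has_G2_def some_other_def by (simp add: graph_rules cong del: if_weak_cong split del: if_split)

section \<open>Evaluation of the certificate\<close>

text \<open>The representatives are computed once.\<close>

schematic_goal pair_list_eq: "pair_list = ?L" unfolding pair_list_def perm_list_def by code_simp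
schematic_goal edge_list_eq: "edge_list = ?L" unfolding edge_list_def perm_list_def by code_simp
schematic_goal K4m_list_eq: "K4m_list = ?L" unfolding K4m_list_def perm_list_def by code_simp
schematic_goal cherry_list_eq: "cherry_list = ?L" unfolding cherry_list_def perm_list_def by code_simp

text \<open>The value of \<open>star_weight\<close> as a decision tree on the six incidences.\<close>

definition star_value :: "bool \<Rightarrow> bool \<Rightarrow> bool \<Rightarrow> bool \<Rightarrow> bool \<Rightarrow> bool \<Rightarrow> int" where
  "star_value p q r s t u = (if p then if q then if r then if s then 0 else if t then 0 else if u then 0 else 1 else 0 else 0
     else if q then 0 else if r then 0 else if s then if t then if u then - 2 else 0 else 0 else 0)"
lemma star_weight_value: "star_weight e a b c d y = star_value (e a b y) (e a c y) (e a d y) (e b c y) (e b d y) (e c d y)"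
  by (simp add: star_weight_def star_value_def)
lemma if_K4m: "(if K4m e a b c d then x else y) = (if e a b c then if e a b d then if e a c d then if e b c d then y else x else y else y else y)"
  by (simp add: K4m_def)
lemma if_cherry: "(if cherry e a b c d then x else y) = (if e a b c then if e a b d then if e a c d then y else if e b c d then y else x else y else y)"
  by (simp add: cherry_def)
schematic_goal six_value_unfold: "six_value (gr [b0, b1, b2, b3, b4, b5, b6, b7, b8, b9, b10, b11, b12, b13, b14, b15, b16, b17, b18, b19]) = ?R"
  unfolding six_value_def pair_list_eq edge_list_eq K4m_list_eq cherry_list_eq
  by (simp add: graph_rules pair_term_def edge_term_def K4m_term_def cherry_term_def if_K4m if_cherry
     star_weight_value cherry_form_def del: dot.simps cong del: if_weak_cong split del: if_split)

text \<open>All values of the five functionals, so that the evaluation multiplies numerals only.\<close>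

lemma vec_table:
  "vec True True True True True True = (288, -140, 0, 0, 0)"
  "vec True True True True True False = (143, -109, 10, 1, 12)"
  "vec True True True True False True = (143, -109, -10, -1, 12)"
  "vec True True True True False False = (92, -45, 0, 0, 13)"
  "vec True True True False True True = (143, -109, 10, -1, -12)"
  "vec True True True False True False = (-20, -67, 11, 0, 0)"
  "vec True True True False False True = (92, -126, 0, 0, 0)"
  "vec True True True False False False = (6, -51, 1, 1, 1)"
  "vec True True False True True True = (143, -109, -10, 1, -12)"
  "vec True True False True True False = (92, -126, 0, 0, 0)"
  "vec True True False True False True = (-20, -67, -11, 0, 0)"
  "vec True True False True False False = (6, -51, -1, -1, 1)"
  "vec True True False False True True = (92, -45, 0, 0, -13)"
  "vec True True False False True False = (6, -51, 1, -1, -1)"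
  "vec True True False False False True = (6, -51, -1, 1, -1)"
  "vec True True False False False False = (-20, -24, 0, 0, 0)"
  "vec True False True True True True = (52, -92, 0, 0, 0)"
  "vec True False True True True False = (-25, -41, 10, -1, 1)"
  "vec True False True True False True = (-25, -41, -10, 1, 1)"
  "vec True False True True False False = (-68, -21, 0, 0, 2)"
  "vec True False True False True True = (-25, -41, 10, 1, -1)"
  "vec True False True False True False = (-68, -43, 14, 0, 0)"
  "vec True False True False False True = (-68, 10, 0, -1, 0)"
  "vec True False True False False False = (-94, -23, 4, -2, 1)"
  "vec True False False True True True = (-25, -41, -10, -1, -1)"
  "vec True False False True True False = (-68, 10, 0, 1, 0)"
  "vec True False False True False True = (-68, -43, -14, 0, 0)"
  "vec True False False True False False = (-94, -23, -4, 2, 1)"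
  "vec True False False False True True = (-68, -21, 0, 0, -2)"
  "vec True False False False True False = (-94, -23, 4, 2, -1)"
  "vec True False False False False True = (-94, -23, -4, -2, -1)"
  "vec True False False False False False = (-80, 0, 0, 0, 0)"
  "vec False True True True True True = (196, -52, 0, 0, 0)"
  "vec False True True True True False = (79, -37, 7, -6, 15)"
  "vec False True True True False True = (79, -37, -7, 6, 15)"
  "vec False True True True False False = (56, 11, 0, 0, 19)"
  "vec False True True False True True = (79, -37, 7, 6, -15)"
  "vec False True True False True False = (-56, -11, 11, 0, 0)"
  "vec False True True False False True = (56, -70, 0, 9, 0)"
  "vec False True True False False False = (-2, -11, 4, 3, 4)"
  "vec False True False True True True = (79, -37, -7, -6, -15)"
  "vec False True False True True False = (56, -70, 0, -9, 0)"
  "vec False True False True False True = (-56, -11, -11, 0, 0)"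
  "vec False True False True False False = (-2, -11, -4, -3, 4)"
  "vec False True False False True True = (56, 11, 0, 0, -19)"
  "vec False True False False True False = (-2, -11, 4, -3, -4)"
  "vec False True False False False True = (-2, -11, -4, 3, -4)"
  "vec False True False False False False = (0, 0, 0, 0, 0)"
  "vec False False True True True True = (40, 0, 0, 0, 0)"
  "vec False False True True True False = (11, 63, 4, -3, 4)"
  "vec False False True True False True = (11, 63, -4, 3, 4)"
  "vec False False True True False False = (-4, 67, 0, 0, 8)"
  "vec False False True False True True = (11, 63, 4, 3, -4)"
  "vec False False True False True False = (-4, 45, 8, 0, 0)"
  "vec False False True False False True = (-4, 98, 0, 3, 0)"
  "vec False False True False False False = (-2, 49, 4, 0, 4)"
  "vec False False False True True True = (11, 63, -4, -3, -4)"
  "vec False False False True True False = (-4, 98, 0, -3, 0)"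
  "vec False False False True False True = (-4, 45, -8, 0, 0)"
  "vec False False False True False False = (-2, 49, -4, 0, 4)"
  "vec False False False False True True = (-4, 67, 0, 0, -8)"
  "vec False False False False True False = (-2, 49, 4, 0, -4)"
  "vec False False False False False True = (-2, 49, -4, 0, -4)"
  "vec False False False False False False = (0, 0, 0, 0, 0)"
  by (simp_all add: vec_def L1_def L2_def L3_def L4_def L5_def star_test_def)
lemma if_True_False: "(if True then x else y) = x" "(if False then x else y) = y"
  by simp_all

lemma all_bits_numeral: "all_bits (numeral k) P =
    (if all_bits (pred_numeral k) (\<lambda>xs. P (True # xs)) then all_bits (pred_numeral k) (\<lambda>xs. P (False # xs)) else False)"
  by (simp add: numeral_eq_Suc)

lemma all_bits_1: "all_bits (Suc 0) P = (if P [True] then P [False] else False)"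
    "all_bits 1 P = (if P [True] then P [False] else False)"
  by simp_all

text \<open>Keeps the simplifier from entering the predicate before the bits are known.\<close>

lemma all_bits_weak_cong: "n = m \<Longrightarrow> all_bits n P = all_bits m P"
  by simp

lemmas evaluation_rules = root_settled_def leaf_settled_def settled_def canonical5_unfold canonical6_unfold last_minimal_unfold
  has_F5_unfold has_F6_unfold has_G1_unfold has_G2_unfold six_value_unfold vec_table dot.simps star_value_def
  lexle.simps count_le.simps append.simps all_bits_numeral all_bits_1 all_bits.simps(1) if_True_False simp_thms
  pred_numeral_simps BitM.simps arith_simps rel_simps semiring_norm mult_zero_left mult_zero_right
  mult_1_left mult_1_right add_0_left add_0_right minus_zero minus_minus diff_zero diff_0
  neg_le_0_iff_le neg_0_le_iff_le

text \<open>The finite part of the certificate: the inequality is evaluated for about 2800 graphs. With weak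
  congruence rules only the branches that are taken are evaluated.\<close>

lemma roots_checked: "all_bits 10 root_settled"
  by (simp only: evaluation_rules cong: if_weak_cong all_bits_weak_cong)

section \<open>The local inequality\<close>

text \<open>Only triples of distinct vertices matter.\<close>

definition agree :: "nat \<Rightarrow> (nat \<Rightarrow> nat \<Rightarrow> nat \<Rightarrow> bool) \<Rightarrow> (nat \<Rightarrow> nat \<Rightarrow> nat \<Rightarrow> bool) \<Rightarrow> bool" where
  "agree n g h \<longleftrightarrow> (\<forall>i j k. i < n \<longrightarrow> j < n \<longrightarrow> k < n \<longrightarrow> i \<noteq> j \<longrightarrow> i \<noteq> k \<longrightarrow> j \<noteq> k \<longrightarrow> g i j k = h i j k)"

lemma agreeD: "agree n g h \<Longrightarrow> i < n \<Longrightarrow> j < n \<Longrightarrow> k < n \<Longrightarrow> i \<noteq> j \<Longrightarrow> i \<noteq> k \<Longrightarrow> j \<noteq> k \<Longrightarrow> g i j k = h i j k"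
  unfolding agree_def by blast

lemma tr_less: "i < n \<Longrightarrow> j < n \<Longrightarrow> x < n \<Longrightarrow> tr i j x < n"
  by (simp add: tr_def)

lemma tr_inj: "tr i j x = tr i j y \<longleftrightarrow> x = y"
  by (auto simp: tr_def)

lemma agree_swg: "agree n g h \<Longrightarrow> i < n \<Longrightarrow> j < n \<Longrightarrow> agree n (swg i j g) (swg i j h)"
  unfolding agree_def swg_def by (simp add: tr_less tr_inj)

lemma bits_agree:
  assumes "agree n g h" "\<forall>(i, j, k)\<in>set ts. i < n \<and> j < n \<and> k < n \<and> i \<noteq> j \<and> i \<noteq> k \<and> j \<noteq> k"
  shows "bits ts g = bits ts h"
  unfolding bits_def
proof (rule map_cong[OF refl], clarify)
  fix i j k assume "(i, j, k) \<in> set ts"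
  then show "g i j k = h i j k" using assms(2) by (intro agreeD[OF assms(1)]) auto
qed

text \<open>Every representative ordering has distinct entries, so only triples of distinct vertices are read.\<close>

lemma six_value_agree:
  assumes "agree 6 g h"
  shows "six_value g = six_value h"
proof -
  have at: "g (p!i) (p!j) (p!k) = h (p!i) (p!j) (p!k)"
    if "p \<in> perms6" "i < 6" "j < 6" "k < 6" "i \<noteq> j" "i \<noteq> k" "j \<noteq> k" for p i j k
    using that by (intro agreeD[OF assms]) (auto simp: perms6_nth perms6_def nth_eq_iff_index_eq)
  have "map (pair_term g) pair_list = map (pair_term h) pair_list"
    by (rule map_cong) (simp_all add: set_pair_list pair_term_def at)
  moreover have "map (edge_term g) edge_list = map (edge_term h) edge_list"
    by (rule map_cong) (simp_all add: set_edge_list edge_term_def at)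
  moreover have "map (K4m_term g) K4m_list = map (K4m_term h) K4m_list"
    by (rule map_cong) (simp_all add: set_K4m_list K4m_term_def K4m_def star_weight_def at)
  moreover have "map (cherry_term g) cherry_list = map (cherry_term h) cherry_list"
    by (rule map_cong) (simp_all add: set_cherry_list cherry_term_def cherry_def cherry_form_def at)
  ultimately show ?thesis unfolding six_value_def by (simp only:)
qed

lemma some_other_iff:
  assumes "n = 5 \<or> n = 6"
  shows "some_other n used P \<longleftrightarrow> (\<exists>i<n. i \<notin> set used \<and> P i)"
proof -
  have "set (take n [0,1,2,3,4,5]) = {..<n}" using assms by (auto simp: numeral_eq_Suc lessThan_Suc)
  then show ?thesis by (auto simp: some_other_def list_ex_iff)
qed

lemma some_other_cong:
  assumes "n = 5 \<or> n = 6" "\<And>i. i < n \<Longrightarrow> i \<notin> set used \<Longrightarrow> P i = Q i"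
  shows "some_other n used P = some_other n used Q"
  unfolding some_other_iff[OF assms(1)] using assms(2) by blast

lemma if_False_conj: "(if P then Q else False) \<longleftrightarrow> P \<and> Q"
  by simp

lemma has_F_E:
  assumes "has_F n g" "n = 5 \<or> n = 6"
  obtains v x a b y where "v < n" "x < n" "a < n" "b < n" "y < n" "distinct [v,x,a,b,y]" "F_at g v x a b y"
proof -
  obtain x a b v y where "x < n" "a < n" "a \<notin> set [x]" "b < n" "b \<notin> set [x,a]" "g x a b"
      "v < n" "v \<notin> set [x,a,b]" "g v x a" "g v x b" "y < n" "y \<notin> set [x,a,b,v]" "g v x y" "g v y a" "g v y b"
    using assms(1) unfolding has_F_def some_other_iff[OF assms(2)] if_False_conj by blast
  then show thesis by (intro that[of v x a b y]) (auto simp: F_at_def)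
qed

lemma has_F6_I:
  assumes "v < 6" "x < 6" "a < 6" "b < 6" "y < 6" "distinct [v,x,a,b,y]" "F_at g v x a b y"
  shows "has_F 6 g"
proof -
  have "\<exists>y<6. y \<notin> set [x,a,b,v] \<and> g v x y \<and> g v y a \<and> g v y b"
    using assms by (intro exI[of _ y]) (auto simp: F_at_def)
  then have "\<exists>v<6. v \<notin> set [x,a,b] \<and> g v x a \<and> g v x b \<and> (\<exists>y<6. y \<notin> set [x,a,b,v] \<and> g v x y \<and> g v y a \<and> g v y b)"
    using assms by (intro exI[of _ v]) (auto simp: F_at_def)
  moreover have "g x a b" "a \<notin> set [x]" "b \<notin> set [x,a]" "x \<notin> set []" using assms by (auto simp: F_at_def)
  ultimately show ?thesis
    unfolding has_F_def some_other_iff[OF disjI2[OF refl]] if_False_conj using assms(2-4) by blast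
qed

lemma has_G1_E:
  assumes "has_G1 g"
  obtains v w x a b y where "v < 6" "w < 6" "x < 6" "a < 6" "b < 6" "y < 6" "distinct [v,w,x,a,b,y]" "G1_at g v w x a b y"
proof -
  obtain x a b v y w where "x < 6" "a < 6" "a \<notin> set [x]" "b < 6" "b \<notin> set [x,a]" "g x a b"
      "v < 6" "v \<notin> set [x,a,b]" "g v x a" "g v x b" "y < 6" "y \<notin> set [x,a,b,v]" "g v y a" "g v y b"
      "w < 6" "w \<notin> set [x,a,b,v,y]" "g w x y"
    using assms unfolding has_G1_def some_other_iff[OF disjI2[OF refl]] if_False_conj by blast
  then show thesis by (intro that[of v w x a b y]) (auto simp: G1_at_def)
qed

lemma has_G2_E:
  assumes "has_G2 g"
  obtains v w x a b y where "v < 6" "w < 6" "x < 6" "a < 6" "b < 6" "y < 6" "distinct [v,w,x,a,b,y]" "G2_at g v w x a b y"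
proof -
  obtain x a b v y w where "x < 6" "a < 6" "a \<notin> set [x]" "b < 6" "b \<notin> set [x,a]" "g x a b"
      "v < 6" "v \<notin> set [x,a,b]" "g v x a" "y < 6" "y \<notin> set [x,a,b,v]" "g v x y" "g v y b"
      "w < 6" "w \<notin> set [x,a,b,v,y]" "g w x b" "g w y a"
    using assms unfolding has_G2_def some_other_iff[OF disjI2[OF refl]] if_False_conj by blast
  then show thesis by (intro that[of v w x a b y]) (auto simp: G2_at_def)
qed

lemma has_agree:
  assumes "agree 6 g h"
  shows "has_F 6 g = has_F 6 h" "has_G1 g = has_G1 h" "has_G2 g = has_G2 h"
  unfolding has_F_def has_G1_def has_G2_def
  by (intro some_other_cong if_cong refl agreeD[OF assms]; auto)+

lemma less_5: "(i::nat) < 5 \<longleftrightarrow> i = 0 \<or> i = 1 \<or> i = 2 \<or> i = 3 \<or> i = 4" by auto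

text \<open>Both relations are determined by their values on increasing triples.\<close>

lemma sorted_agree:
  assumes g: "symmetric3 g" and h: "\<And>i j k. j < i \<Longrightarrow> h i j k = h j i k" "\<And>i j k. k < j \<Longrightarrow> h i j k = h i k j"
    and s: "\<And>i j k. i < j \<Longrightarrow> j < k \<Longrightarrow> k < n \<Longrightarrow> h i j k = g i j k"
  shows "agree n h g"
proof -
  have gs: "g i j k = g j i k" "g i j k = g i k j" for i j k using g unfolding symmetric3_def by blast+
  have "h i j k = g i j k" if ijk: "i < n" "j < n" "k < n" "i \<noteq> j" "i \<noteq> k" "j \<noteq> k" for i j k
  proof -
    consider "i < j" "j < k" | "i < k" "k < j" | "j < i" "i < k" | "j < k" "k < i" | "k < i" "i < j" | "k < j" "j < i"
      using ijk by linarith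
    then show ?thesis
    proof cases
      case 1 then show ?thesis using s ijk by simp
    next
      case 2 then show ?thesis using s[of i k j] h(2)[of k j i] gs(2)[of i j k] ijk by simp
    next
      case 3 then show ?thesis using s[of j i k] h(1)[of j i k] gs(1)[of i j k] ijk by simp
    next
      case 4 then show ?thesis
        using s[of j k i] h(1)[of j i k] h(2)[of k i j] gs(1)[of i j k] gs(2)[of j i k] ijk by simp
    next
      case 5 then show ?thesis
        using s[of k i j] h(2)[of k j i] h(1)[of k i j] gs(2)[of i j k] gs(1)[of i k j] ijk by simp
    next
      case 6 then show ?thesis
        using s[of k j i] h(1)[of j i k] h(2)[of k i j] h(1)[of k j i] gs(1)[of i j k] gs(2)[of j i k] gs(1)[of j k i] ijk by simp
    qed
  qed
  then show ?thesis unfolding agree_def by blast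
qed

text \<open>Reading off the bits of a symmetric relation and decoding them again gives back the relation on
  distinct vertices; for five vertices the remaining bits are irrelevant padding.\<close>

lemma gr_bits:
  assumes "symmetric3 g"
  shows "agree 6 (gr (bits (triples5 @ triples6) g)) g"
    and "agree 5 (gr (pad (bits triples5 g))) g"
proof -
  show "agree 6 (gr (bits (triples5 @ triples6) g)) g"
  proof (rule sorted_agree[OF assms gr_swaps])
    fix i j k :: nat assume ijk: "i < j" "j < k" "k < 6"
    then have "k = 2 \<or> k = 3 \<or> k = 4 \<or> k = 5" "j < 5" "i < 5" by auto
    then show "gr (bits (triples5 @ triples6) g) i j k = g i j k"
      using ijk unfolding bits_def triples5_def triples6_def less_5
      by (elim disjE) (simp_all add: gr_table)
  qed auto
  show "agree 5 (gr (pad (bits triples5 g))) g"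
  proof (rule sorted_agree[OF assms gr_swaps])
    fix i j k :: nat assume ijk: "i < j" "j < k" "k < 5"
    then have "k = 2 \<or> k = 3 \<or> k = 4" "j < 5" "i < 5" by auto
    then show "gr (pad (bits triples5 g)) i j k = g i j k"
      using ijk unfolding bits_def triples5_def less_5 pad_def
      by (elim disjE) (simp_all add: gr_table)
  qed auto
qed

lemma lexle_prefix: "length xs = length us \<Longrightarrow> lexle (xs @ ys) (us @ vs) \<Longrightarrow> lexle xs us"
  by (induction xs us rule: list_induct2) (auto split: if_splits)

lemma triples_ok:
  "\<forall>(i, j, k)\<in>set triples5. i < 5 \<and> j < 5 \<and> k < 5 \<and> i \<noteq> j \<and> i \<noteq> k \<and> j \<noteq> k"
  "\<forall>(i, j, k)\<in>set (triples5 @ triples6). i < 6 \<and> j < 6 \<and> k < 6 \<and> i \<noteq> j \<and> i \<noteq> k \<and> j \<noteq> k"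
  "\<forall>(i, j, k)\<in>set triples6. i < 6 \<and> j < 6 \<and> k < 6 \<and> i \<noteq> j \<and> i \<noteq> k \<and> j \<noteq> k"
  "\<forall>(i, j)\<in>set transp5. i < 5 \<and> j < 5 \<and> i \<noteq> j"
  by (auto simp: triples5_def triples6_def transp5_def)

lemma last_minimal_agree:
  assumes "agree 6 g h"
  shows "last_minimal g = last_minimal h"
proof -
  have "set (link_without i) \<subseteq> set (triples5 @ triples6)" "set (triples_at i) \<subseteq> set (triples5 @ triples6)" for i
    by (auto simp: link_without_def triples_at_def)
  then have "bits (link_without i) g = bits (link_without i) h" "bits (triples_at i) g = bits (triples_at i) h" for i
    using triples_ok(2) by (intro bits_agree[OF assms]; blast)+
  then show ?thesis by (simp add: last_minimal_def)
qed

text \<open>The relation is replaced by its bit encoding, the first ten bits select a root of the search tree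
  and the other ten bits a leaf.\<close>

lemma six_value_nonpos_canonical:
  assumes g: "symmetric3 g" and lm: "last_minimal g"
    and can: "\<forall>(i, j)\<in>set transp5. lexle (bits (triples5 @ triples6) (swg i j g)) (bits (triples5 @ triples6) g)"
    and F: "\<not> has_F 6 g" and G12: "\<not> has_G1 g \<or> \<not> has_G2 g"
  shows "six_value g \<le> 0"
proof -
  let ?xs = "bits triples5 g" and ?ys = "bits triples6 g"
  let ?B = "bits (triples5 @ triples6) g"
  have B: "?B = ?xs @ ?ys" by (simp add: bits_def)
  have len: "length ?xs = 10" "length ?ys = 10" by (simp_all add: bits_def triples5_def triples6_def)
  note a6 = gr_bits(1)[OF g] and a5 = gr_bits(2)[OF g]
  have "root_settled ?xs" using roots_checked len unfolding all_bits_iff by blast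
  moreover have "canonical5 ?xs"
    unfolding canonical5_def each_iff
  proof clarify
    fix i j assume ij: "(i, j) \<in> set transp5"
    then have "i < 5" "j < 5" using triples_ok(4) by auto
    then have "bits triples5 (swg i j (gr (pad ?xs))) = bits triples5 (swg i j g)"
      by (intro bits_agree[OF agree_swg[OF a5] triples_ok(1)])
    moreover have "lexle (bits triples5 (swg i j g) @ bits triples6 (swg i j g)) (?xs @ ?ys)"
      using can ij by (auto simp: bits_def)
    then have "lexle (bits triples5 (swg i j g)) ?xs" by (rule lexle_prefix[rotated]) (simp add: bits_def)
    ultimately show "lexle (bits triples5 (swg i j (gr (pad ?xs)))) ?xs" by simp
  qed
  moreover have "\<not> has_F 5 (gr (pad ?xs))"
  proof
    assume "has_F 5 (gr (pad ?xs))"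
    then obtain v x a b y where *: "v < 5" "x < 5" "a < 5" "b < 5" "y < 5" "distinct [v,x,a,b,y]"
        "F_at (gr (pad ?xs)) v x a b y"
      by (rule has_F_E) auto
    then have "y \<noteq> a" "y \<noteq> b" by auto
    with * have "F_at g v x a b y" by (simp add: F_at_def agreeD[OF a5])
    then have "has_F 6 g" using * by (intro has_F6_I) auto
    then show False using F by simp
  qed
  ultimately have "all_bits 10 (leaf_settled ?xs)" unfolding root_settled_def by simp
  then have "leaf_settled ?xs ?ys" using len unfolding all_bits_iff by blast
  moreover have "last_minimal (gr ?B)" using lm last_minimal_agree[OF a6] by simp
  moreover have "canonical6 ?B"
    unfolding canonical6_def each_iff
  proof clarify
    fix i j assume ij: "(i, j) \<in> set transp5"
    then have "i < 6" "j < 6" using triples_ok(4) by auto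
    then have "bits (triples5 @ triples6) (swg i j (gr ?B)) = bits (triples5 @ triples6) (swg i j g)"
      by (intro bits_agree[OF agree_swg[OF a6] triples_ok(2)])
    then show "lexle (bits (triples5 @ triples6) (swg i j (gr ?B))) ?B" using can ij by auto
  qed
  ultimately have "settled ?B" unfolding leaf_settled_def B by simp
  moreover note has_agree[OF a6]
  ultimately have "six_value (gr ?B) \<le> 0" using F G12 unfolding settled_def by (auto split: if_splits)
  then show ?thesis using six_value_agree[OF a6] by simp
qed

text \<open>Reading bits as a binary number turns lexicographic maxima into maxima of natural numbers.\<close>

fun num :: "bool list \<Rightarrow> nat" where
  "num [] = 0"
| "num (x # xs) = of_bool x * 2 ^ length xs + num xs"

lemma num_less: "num xs < 2 ^ length xs"
  by (induction xs) auto

lemma lexle_num: "length xs = length ys \<Longrightarrow> num xs \<le> num ys \<Longrightarrow> lexle xs ys"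
proof (induction xs ys rule: list_induct2)
  case (Cons x xs y ys)
  then show ?case using num_less[of xs] num_less[of ys] by (cases x; cases y) auto
qed simp

definition cnt :: "bool list \<Rightarrow> nat" where "cnt xs = (\<Sum>b\<leftarrow>xs. of_bool b)"

lemma count_le_cnt: "count_le xs ys \<longleftrightarrow> cnt xs \<le> cnt ys"
  by (induction xs ys rule: count_le.induct) (auto simp: cnt_def)

text \<open>The relation induced on the positions of a tuple.\<close>

definition ind :: "('v \<Rightarrow> 'v \<Rightarrow> 'v \<Rightarrow> bool) \<Rightarrow> 'v list \<Rightarrow> nat \<Rightarrow> nat \<Rightarrow> nat \<Rightarrow> bool" where
  "ind e t i j k = e (t!i) (t!j) (t!k)"

lemma symmetric3_ind: "symmetric3 e \<Longrightarrow> symmetric3 (ind e t)"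
  unfolding symmetric3_def ind_def by blast

lemma pick_sw_tr:
  assumes "p \<in> perms6" "i < 6" "j < 6" "k < 6"
  shows "pick t (sw i j p) ! k = pick t p ! tr i j k"
proof -
  have "length (sw i j p) = 6" "length p = 6"
    using sw_perms6[OF assms(1-3)] assms(1) by (auto simp: perms6_def)
  then show ?thesis using assms(2-4) by (simp add: pick_nth sw_nth tr_def)
qed

lemma ind_sw:
  assumes "p \<in> perms6" "i < 6" "j < 6"
  shows "agree 6 (ind e (pick t (sw i j p))) (swg i j (ind e (pick t p)))"
  unfolding agree_def ind_def swg_def by (simp add: pick_sw_tr assms)

text \<open>The multiplicities of the four kinds of terms combine with the weights in
  \<open>local_term\<close> to the common factor $12$.\<close>

lemma sum_perms6_eq_six_value:
  assumes "symmetric3 e" "length t = 6"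
  shows "(\<Sum>p\<in>perms6. local_term e (pick t p)) = 12 * six_value (ind e t)"
proof -
  have len: "length p = 6" if "p \<in> perms6" for p using that by (simp add: perms6_def)
  have "map (\<lambda>p. pair_term e (pick t p)) pair_list = map (pair_term (ind e t)) pair_list"
    by (rule map_cong) (auto simp: set_pair_list pair_term_def ind_def pick_nth len)
  moreover have "map (\<lambda>p. edge_term e (pick t p)) edge_list = map (edge_term (ind e t)) edge_list"
    by (rule map_cong) (auto simp: set_edge_list edge_term_def ind_def pick_nth len)
  moreover have "map (\<lambda>p. K4m_term e (pick t p)) K4m_list = map (K4m_term (ind e t)) K4m_list"
    by (rule map_cong) (simp_all add: set_K4m_list K4m_term_def K4m_def star_weight_def ind_def pick_nth len)
  moreover have "map (\<lambda>p. cherry_term e (pick t p)) cherry_list = map (cherry_term (ind e t)) cherry_list"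
    by (rule map_cong) (simp_all add: set_cherry_list cherry_term_def cherry_def cherry_form_def ind_def pick_nth len)
  ultimately have sums:
      "(\<Sum>p\<in>perms6. pair_term e (pick t p)) = 8 * (\<Sum>p\<leftarrow>pair_list. pair_term (ind e t) p)"
      "(\<Sum>p\<in>perms6. edge_term e (pick t p)) = 36 * (\<Sum>p\<leftarrow>edge_list. edge_term (ind e t) p)"
      "(\<Sum>p\<in>perms6. K4m_term e (pick t p)) = 12 * (\<Sum>p\<leftarrow>K4m_list. K4m_term (ind e t) p)"
      "(\<Sum>p\<in>perms6. cherry_term e (pick t p)) = 8 * (\<Sum>p\<leftarrow>cherry_list. cherry_term (ind e t) p)"
    unfolding sum_pair_term[OF assms(1)] sum_edge_term[OF assms(1)] sum_K4m_term[OF assms(1)]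
      sum_cherry_term[OF assms(1)] by (simp_all only:)
  have "(\<Sum>p\<in>perms6. local_term e (pick t p)) =
      6400 * (9 * (\<Sum>p\<in>perms6. pair_term e (pick t p)) - 4 * (\<Sum>p\<in>perms6. edge_term e (pick t p)))
      + 19200 * (\<Sum>p\<in>perms6. K4m_term e (pick t p)) + 3 * (\<Sum>p\<in>perms6. cherry_term e (pick t p))"
    unfolding local_term_def by (simp only: sum.distrib sum_subtractf sum_distrib_left right_diff_distrib)
  then show ?thesis unfolding sums six_value_def by (simp only: algebra_simps)
qed

lemma cnt_bits: "cnt (bits ts g) = (\<Sum>(i, j, k)\<leftarrow>ts. of_bool (g i j k))"
  unfolding cnt_def bits_def by (induction ts) auto

text \<open>The triples that contain both $i$ and $5$ contribute equally to both degrees and cancel.\<close>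

lemma cnt_triples6_swap_last:
  assumes g: "symmetric3 g" and i: "i < 5"
    and le: "cnt (bits triples6 g) \<le> cnt (bits triples6 (swg i 5 g))"
  shows "count_le (bits (link_without i) g) (bits (triples_at i) g)"
proof -
  have gs: "g a b c = g b a c" "g a b c = g a c b" for a b c using g unfolding symmetric3_def by blast+
  have gsd: "b < a \<Longrightarrow> g a b c = g b a c" "c < b \<Longrightarrow> g a b c = g a c b" for a b c using gs by blast+
  show ?thesis
    using i le unfolding count_le_cnt cnt_bits link_without_def triples_at_def triples5_def triples6_def less_5 swg_def tr_def
    by (elim disjE) (simp_all add: gsd)
qed

lemma cnt_triples6_swap:
  assumes g: "symmetric3 g" and ij: "(i, j) \<in> set transp5"
  shows "cnt (bits triples6 (swg i j g)) = cnt (bits triples6 g)"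
proof -
  have gs: "g a b c = g b a c" "g a b c = g a c b" for a b c using g unfolding symmetric3_def by blast+
  have gsd: "b < a \<Longrightarrow> g a b c = g b a c" "c < b \<Longrightarrow> g a b c = g a c b" for a b c using gs by blast+
  have "\<forall>(i, j)\<in>set transp5. cnt (bits triples6 (swg i j g)) = cnt (bits triples6 g)"
    unfolding transp5_def
    by ((simp add: cnt_bits triples6_def swg_def tr_def gsd; fail) |
        (simp add: cnt_bits triples6_def swg_def tr_def gsd add_ac; fail))
  from bspec[OF this ij] show ?thesis by simp
qed

text \<open>First minimise the degree of the last vertex; among the minimal orderings take the one whose bits
  are lexicographically largest. Transpositions of the first five vertices keep the degree of the
  last one, so they cannot increase the bits.\<close>

lemma good_ordering:
  assumes e: "symmetric3 e"
  obtains \<rho> where "\<rho> \<in> perms6" "last_minimal (ind e (pick t \<rho>))"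
    "\<forall>(i, j)\<in>set transp5. lexle (bits (triples5 @ triples6) (swg i j (ind e (pick t \<rho>))))
        (bits (triples5 @ triples6) (ind e (pick t \<rho>)))"
proof -
  let ?g = "\<lambda>\<rho>. ind e (pick t \<rho>)"
  let ?d = "\<lambda>\<rho>. cnt (bits triples6 (?g \<rho>))"
  let ?N = "\<lambda>\<rho>. num (bits (triples5 @ triples6) (?g \<rho>))"
  have "[0,1,2,3,4,5] \<in> perms6" by (auto simp: perms6_def)
  then have ne: "perms6 \<noteq> {}" by blast
  define m where "m = Min (?d ` perms6)"
  let ?M = "{\<rho>\<in>perms6. ?d \<rho> = m}"
  have m: "m \<le> ?d \<rho>" if "\<rho> \<in> perms6" for \<rho> unfolding m_def using that finite_perms6 by simp
  have "m \<in> ?d ` perms6" unfolding m_def using Min_in finite_perms6 ne by simp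
  then have M: "?M \<noteq> {}" "finite ?M" using finite_perms6 by auto
  have "Max (?N ` ?M) \<in> ?N ` ?M" using Max_in M by simp
  then obtain \<rho> where \<rho>: "\<rho> \<in> ?M" and N: "?N \<rho> = Max (?N ` ?M)" by auto
  have max: "?N \<sigma> \<le> ?N \<rho>" if "\<sigma> \<in> ?M" for \<sigma> unfolding N using that M by simp
  have mem: "\<rho> \<in> perms6" using \<rho> by simp
  note sym = symmetric3_ind[OF e, of "pick t \<rho>"]
  have "count_le (bits (link_without i) (?g \<rho>)) (bits (triples_at i) (?g \<rho>))" if "i < 5" for i
  proof (rule cnt_triples6_swap_last[OF sym that])
    have "sw i 5 \<rho> \<in> perms6" using mem that by (simp add: sw_perms6)
    then have "?d \<rho> \<le> ?d (sw i 5 \<rho>)" using m \<rho> by simp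
    also have "\<dots> = cnt (bits triples6 (swg i 5 (?g \<rho>)))"
      using that by (subst bits_agree[OF ind_sw[OF mem] triples_ok(3)]) auto
    finally show "?d \<rho> \<le> cnt (bits triples6 (swg i 5 (?g \<rho>)))" .
  qed
  then have lm: "last_minimal (?g \<rho>)" unfolding last_minimal_def each_iff by auto
  have "lexle (bits (triples5 @ triples6) (swg i j (?g \<rho>))) (bits (triples5 @ triples6) (?g \<rho>))"
    if ij: "(i, j) \<in> set transp5" for i j
  proof (rule lexle_num)
    have lt: "i < 6" "j < 6" using ij triples_ok(4) by auto
    have "?d (sw i j \<rho>) = ?d \<rho>"
      using bits_agree[OF ind_sw[OF mem lt] triples_ok(3), of e t] cnt_triples6_swap[OF sym ij] by simp
    then have "sw i j \<rho> \<in> ?M" using \<rho> lt by (simp add: sw_perms6)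
    then have "?N (sw i j \<rho>) \<le> ?N \<rho>" by (rule max)
    then show "num (bits (triples5 @ triples6) (swg i j (?g \<rho>))) \<le> ?N \<rho>"
      using bits_agree[OF ind_sw[OF mem lt] triples_ok(2), of e t] by simp
  qed (simp add: bits_def)
  then show thesis using that[OF mem lm] by blast
qed

text \<open>The sum over all orderings does not change when the tuple is reordered, so it may be evaluated in
  the ordering of \<open>good_ordering\<close>.\<close>

lemma local_sum_nonpos:
  assumes e: "symmetric3 e" and t: "length t = 6" "distinct t"
    and F: "\<And>v x a b y. {v,x,a,b,y} \<subseteq> set t \<Longrightarrow> distinct [v,x,a,b,y] \<Longrightarrow> \<not> F_at e v x a b y"
    and G12: "(\<forall>v w x a b y. {v,w,x,a,b,y} \<subseteq> set t \<longrightarrow> distinct [v,w,x,a,b,y] \<longrightarrow> \<not> G1_at e v w x a b y) \<or>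
              (\<forall>v w x a b y. {v,w,x,a,b,y} \<subseteq> set t \<longrightarrow> distinct [v,w,x,a,b,y] \<longrightarrow> \<not> G2_at e v w x a b y)"
  shows "(\<Sum>p\<in>perms6. local_term e (pick t p)) \<le> 0"
proof -
  obtain \<rho> where \<rho>: "\<rho> \<in> perms6" "last_minimal (ind e (pick t \<rho>))"
    "\<forall>(i, j)\<in>set transp5. lexle (bits (triples5 @ triples6) (swg i j (ind e (pick t \<rho>))))
        (bits (triples5 @ triples6) (ind e (pick t \<rho>)))"
    using good_ordering[OF e] by blast
  let ?u = "pick t \<rho>"
  have u: "length ?u = 6" "distinct ?u" "set ?u = set t"
    using pick_distinct[OF \<rho>(1) t] set_pick[OF \<rho>(1) t(1)] \<rho>(1) by (simp_all add: perms6_def)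
  have ne: "?u ! i = ?u ! j \<longleftrightarrow> i = j" if "i < 6" "j < 6" for i j
    using that u by (simp add: nth_eq_iff_index_eq)
  have in_t: "?u ! i \<in> set t" if "i < 6" for i using that u by (metis nth_mem)
  have nF: "\<not> has_F 6 (ind e ?u)"
  proof
    assume "has_F 6 (ind e ?u)"
    then obtain v x a b y where *: "v < 6" "x < 6" "a < 6" "b < 6" "y < 6" "distinct [v,x,a,b,y]"
        "F_at (ind e ?u) v x a b y"
      by (rule has_F_E) auto
    then show False using F[of "?u!v" "?u!x" "?u!a" "?u!b" "?u!y"]
      by (simp add: F_at_def ind_def ne in_t)
  qed
  have nG1: "\<not> has_G1 (ind e ?u)"
    if h: "\<forall>v w x a b y. {v,w,x,a,b,y} \<subseteq> set t \<longrightarrow> distinct [v,w,x,a,b,y] \<longrightarrow> \<not> G1_at e v w x a b y"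
  proof
    assume "has_G1 (ind e ?u)"
    then obtain v w x a b y where *: "v < 6" "w < 6" "x < 6" "a < 6" "b < 6" "y < 6" "distinct [v,w,x,a,b,y]"
        "G1_at (ind e ?u) v w x a b y" by (rule has_G1_E)
    then show False using h[rule_format, of "?u!v" "?u!w" "?u!x" "?u!a" "?u!b" "?u!y"]
      by (simp add: G1_at_def ind_def ne in_t)
  qed
  have nG2: "\<not> has_G2 (ind e ?u)"
    if h: "\<forall>v w x a b y. {v,w,x,a,b,y} \<subseteq> set t \<longrightarrow> distinct [v,w,x,a,b,y] \<longrightarrow> \<not> G2_at e v w x a b y"
  proof
    assume "has_G2 (ind e ?u)"
    then obtain v w x a b y where *: "v < 6" "w < 6" "x < 6" "a < 6" "b < 6" "y < 6" "distinct [v,w,x,a,b,y]"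
        "G2_at (ind e ?u) v w x a b y" by (rule has_G2_E)
    then show False using h[rule_format, of "?u!v" "?u!w" "?u!x" "?u!a" "?u!b" "?u!y"]
      by (simp add: G2_at_def ind_def ne in_t)
  qed
  have "six_value (ind e ?u) \<le> 0"
    by (rule six_value_nonpos_canonical[OF symmetric3_ind[OF e] \<rho>(2,3) nF]) (use G12 nG1 nG2 in blast)
  moreover have "(\<Sum>p\<in>perms6. local_term e (pick t p)) = (\<Sum>p\<in>perms6. local_term e (pick ?u p))"
    using sum_pick_invariant[OF \<rho>(1), of "local_term e" t] by simp
  ultimately show ?thesis using sum_perms6_eq_six_value[OF e u(1)] by simp
qed

section \<open>Summing over all tuples\<close>

lemma vec_bound:
  "\<bar>L1 (of_bool p) (of_bool q) (of_bool a) (of_bool b) (of_bool c) (of_bool d)\<bar> \<le> 1000"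
  "\<bar>L2 (of_bool p) (of_bool q) (of_bool a) (of_bool b) (of_bool c) (of_bool d)\<bar> \<le> 1000"
  "\<bar>L3 (of_bool p) (of_bool q) (of_bool a) (of_bool b) (of_bool c) (of_bool d)\<bar> \<le> 1000"
  "\<bar>L4 (of_bool p) (of_bool q) (of_bool a) (of_bool b) (of_bool c) (of_bool d)\<bar> \<le> 1000"
  "\<bar>L5 (of_bool p) (of_bool q) (of_bool a) (of_bool b) (of_bool c) (of_bool d)\<bar> \<le> 1000"
  by (cases p; cases q; cases a; cases b; cases c; cases d;
      simp add: L1_def L2_def L3_def L4_def L5_def star_test_def)+

lemma mult_bound:
  fixes x y :: int
  assumes "\<bar>x\<bar> \<le> B" "\<bar>y\<bar> \<le> B"
  shows "x * y \<le> B * B"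
proof -
  have "x * y \<le> \<bar>x\<bar> * \<bar>y\<bar>" by (metis abs_ge_self abs_mult)
  also have "\<dots> \<le> B * B" using assms by (intro mult_mono) auto
  finally show ?thesis .
qed

text \<open>The bound is the trace of the diagonal form, $943$, times $1000^2$.\<close>

lemma cherry_form_bound: "cherry_form e a b c d y z \<le> 943000000"
proof -
  have "dot (vec p q a b c d) (vec p' q' a' b' c' d') \<le> 943000000" for p q a b c d p' q' a' b' c' d'
    using mult_bound[OF vec_bound(1)[of p q a b c d] vec_bound(1)[of p' q' a' b' c' d']]
      mult_bound[OF vec_bound(2)[of p q a b c d] vec_bound(2)[of p' q' a' b' c' d']]
      mult_bound[OF vec_bound(3)[of p q a b c d] vec_bound(3)[of p' q' a' b' c' d']]
      mult_bound[OF vec_bound(4)[of p q a b c d] vec_bound(4)[of p' q' a' b' c' d']]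
      mult_bound[OF vec_bound(5)[of p q a b c d] vec_bound(5)[of p' q' a' b' c' d']]
    unfolding vec_def Let_def dot.simps by linarith
  then show ?thesis unfolding cherry_form_def .
qed

text \<open>Any bound that does not depend on the graph would do; it only enters the error term.\<close>

lemma local_term_bound: "local_term e t \<le> 3000000000"
proof -
  have s: "\<bar>star_weight e a b c d y\<bar> \<le> 2" for a b c d y
    by (auto simp: star_weight_def)
  have "K4m_term e t \<le> 4" unfolding K4m_term_def using mult_bound[OF s s] by auto
  moreover have "cherry_term e t \<le> 943000000" unfolding cherry_term_def using cherry_form_bound by auto
  moreover have "pair_term e t \<le> 1" "edge_term e t \<ge> 0" by (auto simp: pair_term_def edge_term_def)
  ultimately show ?thesis unfolding local_term_def right_diff_distrib by linarith
qed

definition degree :: "'v set \<Rightarrow> ('v \<Rightarrow> 'v \<Rightarrow> 'v \<Rightarrow> bool) \<Rightarrow> 'v \<Rightarrow> int" where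
  "degree V e v = (\<Sum>a\<in>V. \<Sum>b\<in>V. of_bool (e v a b))"

lemma sum_tuples6:
  "(\<Sum>t\<in>tuples V 6. f t) = (\<Sum>a\<in>V. \<Sum>b\<in>V. \<Sum>c\<in>V. \<Sum>d\<in>V. \<Sum>y\<in>V. \<Sum>z\<in>V. (f [a,b,c,d,y,z] :: int))"
  by (simp add: numeral_eq_Suc sum_tuples_Suc tuples_0)

lemma nth6: "[a,b,c,d,y,z]!0 = a" "[a,b,c,d,y,z]!1 = b" "[a,b,c,d,y,z]!2 = c" "[a,b,c,d,y,z]!3 = d"
  "[a,b,c,d,y,z]!4 = y" "[a,b,c,d,y,z]!5 = z"
  by simp_all

lemma sum_pair_tuples:
  "(\<Sum>t\<in>tuples V 6. pair_term e t) = int (card V) * (\<Sum>v\<in>V. degree V e v ^ 2)"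
proof -
  have "(\<Sum>t\<in>tuples V 6. pair_term e t)
      = (\<Sum>v\<in>V. \<Sum>a\<in>V. \<Sum>b\<in>V. \<Sum>c\<in>V. \<Sum>d\<in>V. int (card V) * (of_bool (e v a b) * of_bool (e v c d)))"
    unfolding sum_tuples6 pair_term_def nth6 by (intro sum.cong refl) auto
  also have "\<dots> = int (card V) * (\<Sum>v\<in>V. \<Sum>a\<in>V. \<Sum>b\<in>V. of_bool (e v a b) * degree V e v)"
    unfolding degree_def by (simp only: sum_distrib_left)
  also have "\<dots> = int (card V) * (\<Sum>v\<in>V. degree V e v ^ 2)"
    by (simp only: sum_distrib_right[symmetric] degree_def[symmetric] power2_eq_square)
  finally show ?thesis .
qed

lemma sum_edge_tuples:
  "(\<Sum>t\<in>tuples V 6. edge_term e t) = int (card V) ^ 3 * (\<Sum>v\<in>V. degree V e v)"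
proof -
  have "(\<Sum>t\<in>tuples V 6. edge_term e t)
      = (\<Sum>v\<in>V. \<Sum>a\<in>V. \<Sum>b\<in>V. int (card V) ^ 3 * of_bool (e v a b))"
    unfolding sum_tuples6 edge_term_def nth6 by (intro sum.cong refl) (auto simp: power3_eq_cube)
  then show ?thesis unfolding degree_def by (simp only: sum_distrib_left)
qed

lemma sum_square: "(\<Sum>y\<in>V. \<Sum>z\<in>V. f y * f z) = (\<Sum>y\<in>V. f y) ^ 2" for f :: "'v \<Rightarrow> int"
  by (simp add: power2_eq_square sum_product)

text \<open>For a fixed four-set the last two positions are independent, so the products add up to the square
  of a sum.\<close>

lemma sum_K4m_tuples: "0 \<le> (\<Sum>t\<in>tuples V 6. K4m_term e t)"
proof -
  have "(\<Sum>t\<in>tuples V 6. K4m_term e t) = (\<Sum>a\<in>V. \<Sum>b\<in>V. \<Sum>c\<in>V. \<Sum>d\<in>V.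
      if K4m e a b c d then (\<Sum>y\<in>V. star_weight e a b c d y) ^ 2 else 0)"
    unfolding sum_tuples6 K4m_term_def nth6 by (intro sum.cong refl) (simp add: sum_square)
  then show ?thesis by (auto intro!: sum_nonneg)
qed

text \<open>As for \<open>sum_K4m_tuples\<close>, now with five squares of positive weight.\<close>

lemma sum_cherry_tuples: "0 \<le> (\<Sum>t\<in>tuples V 6. cherry_term e t)"
proof -
  have form: "0 \<le> (\<Sum>y\<in>V. \<Sum>z\<in>V. cherry_form e a b c d y z)" for a b c d
  proof -
    define l where "l L y = L (of_bool (e a b y)) (of_bool (e c d y)) (of_bool (e a c y)) (of_bool (e a d y))
      (of_bool (e b c y)) (of_bool (e b d y))" for L :: "int \<Rightarrow> int \<Rightarrow> int \<Rightarrow> int \<Rightarrow> int \<Rightarrow> int \<Rightarrow> int" and y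
    have "(\<Sum>y\<in>V. \<Sum>z\<in>V. cherry_form e a b c d y z) = (\<Sum>y\<in>V. \<Sum>z\<in>V. 4 * (l L1 y * l L1 z)
        + 3 * (l L2 y * l L2 z) + 308 * (l L3 y * l L3 z) + 500 * (l L4 y * l L4 z) + 128 * (l L5 y * l L5 z))"
      unfolding cherry_form_def vec_def Let_def dot.simps l_def ..
    also have "\<dots> = 4 * (\<Sum>y\<in>V. l L1 y)^2 + 3 * (\<Sum>y\<in>V. l L2 y)^2 + 308 * (\<Sum>y\<in>V. l L3 y)^2
        + 500 * (\<Sum>y\<in>V. l L4 y)^2 + 128 * (\<Sum>y\<in>V. l L5 y)^2"
      by (simp only: sum.distrib sum_distrib_left[symmetric] sum_distrib_right[symmetric] power2_eq_square)
    finally show ?thesis by simp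
  qed
  have "(\<Sum>t\<in>tuples V 6. cherry_term e t) = (\<Sum>a\<in>V. \<Sum>b\<in>V. \<Sum>c\<in>V. \<Sum>d\<in>V.
      if cherry e a b c d then (\<Sum>y\<in>V. \<Sum>z\<in>V. cherry_form e a b c d y z) else 0)"
    unfolding sum_tuples6 cherry_term_def nth6 by (intro sum.cong refl) simp
  then show ?thesis using form by (auto intro!: sum_nonneg)
qed

lemma sum_local_tuples_ge:
  "6400 * (9 * (int (card V) * (\<Sum>v\<in>V. degree V e v ^ 2)) - 4 * (int (card V) ^ 3 * (\<Sum>v\<in>V. degree V e v)))
     \<le> (\<Sum>t\<in>tuples V 6. local_term e t)"
proof -
  have "(\<Sum>t\<in>tuples V 6. local_term e t) =
      6400 * (9 * (\<Sum>t\<in>tuples V 6. pair_term e t) - 4 * (\<Sum>t\<in>tuples V 6. edge_term e t))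
      + 19200 * (\<Sum>t\<in>tuples V 6. K4m_term e t) + 3 * (\<Sum>t\<in>tuples V 6. cherry_term e t)"
    unfolding local_term_def by (simp only: sum.distrib sum_subtractf sum_distrib_left right_diff_distrib)
  then show ?thesis
    using sum_K4m_tuples[of e V] sum_cherry_tuples[of e V] by (simp add: sum_pair_tuples sum_edge_tuples)
qed

section \<open>Exceptional tuples\<close>

lemma card_perms6: "card perms6 \<le> 46656"
proof -
  have "card perms6 \<le> card (tuples {..<6::nat} 6)"
    by (rule card_mono[OF finite_tuples]) (auto simp: perms6_def tuples_def)
  then show ?thesis by (simp add: card_tuples)
qed

text \<open>Together with \<open>F_tuples\<close> these are the tuples on which the local inequality may fail.\<close>

definition repeating :: "'v set \<Rightarrow> nat \<Rightarrow> nat \<Rightarrow> 'v list set" where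
  "repeating V i j = {t\<in>tuples V 6. t!i = t!j}"

definition F_tuples :: "'v set \<Rightarrow> ('v \<Rightarrow> 'v \<Rightarrow> 'v \<Rightarrow> bool) \<Rightarrow> nat list \<Rightarrow> 'v list set" where
  "F_tuples V e p = {t\<in>tuples V 6. distinct t \<and> F_at e (t!(p!0)) (t!(p!1)) (t!(p!2)) (t!(p!3)) (t!(p!4))}"

lemma card_repeating:
  assumes "finite V" "i < 6" "j < 6" "i \<noteq> j"
  shows "card (repeating V i j) \<le> card V ^ 5"
  by (rule card_determined_coordinate[OF assms(1) _ assms(3)])
     (use assms in \<open>auto simp: repeating_def\<close>)

text \<open>If two such tuples differ only at the position of $v$, the two candidates for $v$ and the other
  four vertices span both \<open>G1\<close> and \<open>G2\<close>. So the other five entries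
  determine the entry at this position.\<close>

lemma card_F_tuples:
  assumes V: "finite V" and p: "p \<in> perms6"
    and G12: "(\<forall>v w x a b y. {v,w,x,a,b,y} \<subseteq> V \<longrightarrow> distinct [v,w,x,a,b,y] \<longrightarrow> \<not> G1_at e v w x a b y) \<or>
              (\<forall>v w x a b y. {v,w,x,a,b,y} \<subseteq> V \<longrightarrow> distinct [v,w,x,a,b,y] \<longrightarrow> \<not> G2_at e v w x a b y)"
  shows "card (F_tuples V e p) \<le> card V ^ 5"
proof (rule card_determined_coordinate[OF V])
  show "p ! 0 < 6" using p by (simp add: perms6_nth)
  fix t u assume t: "t \<in> F_tuples V e p" and u: "u \<in> F_tuples V e p"
    and same: "\<And>i. i < 6 \<Longrightarrow> i \<noteq> p ! 0 \<Longrightarrow> t ! i = u ! i"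
  show "t ! (p ! 0) = u ! (p ! 0)"
  proof (rule ccontr)
    assume ne: "t ! (p ! 0) \<noteq> u ! (p ! 0)"
    have pd: "p ! i \<noteq> p ! j" "p ! i < 6" if "i < 6" "j < 6" "i \<noteq> j" for i j
      using p that by (auto simp: perms6_def nth_eq_iff_index_eq perms6_nth[OF p])
    have len: "length t = 6" "length u = 6" "distinct t" "distinct u" "set t \<subseteq> V" "set u \<subseteq> V"
      using t u by (auto simp: F_tuples_def tuples_def)
    have s: "u ! (p ! i) = t ! (p ! i)" if "0 < i" "i < 6" for i
      using same[of "p ! i"] pd[of i 0] that by auto
    have d: "t ! (p ! i) \<noteq> t ! (p ! j)" "u ! (p ! i) \<noteq> u ! (p ! j)" if "i < 6" "j < 6" "i \<noteq> j" for i j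
      using pd[OF that] pd(2)[of j i] that len by (auto simp: nth_eq_iff_index_eq)
    have inV: "t ! (p ! i) \<in> V" "u ! (p ! i) \<in> V" if "i < 6" for i
      using perms6_nth[OF p that] len by (metis nth_mem subsetD)+
    let ?v = "t ! (p ! 0)" and ?w = "u ! (p ! 0)"
    let ?x = "t ! (p ! 1)" and ?a = "t ! (p ! 2)" and ?b = "t ! (p ! 3)" and ?y = "t ! (p ! 4)"
    have Ft: "F_at e ?v ?x ?a ?b ?y" using t by (simp add: F_tuples_def)
    have Fu: "F_at e ?w ?x ?a ?b ?y" using u s[of 1] s[of 2] s[of 3] s[of 4] by (simp add: F_tuples_def)
    have dist: "distinct [?v, ?w, ?x, ?a, ?b, ?y]"
      using ne d(1)[of 0 1] d(1)[of 0 2] d(1)[of 0 3] d(1)[of 0 4] d(1)[of 1 2] d(1)[of 1 3] d(1)[of 1 4]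
        d(1)[of 2 3] d(1)[of 2 4] d(1)[of 3 4] d(2)[of 0 1] d(2)[of 0 2] d(2)[of 0 3] d(2)[of 0 4]
        s[of 1] s[of 2] s[of 3] s[of 4] by simp
    have sub: "{?v, ?w, ?x, ?a, ?b, ?y} \<subseteq> V" using inV by simp
    have at: "G1_at e ?v ?w ?x ?a ?b ?y" "G2_at e ?v ?w ?x ?a ?b ?y"
      using Ft Fu by (auto simp: F_at_def G1_at_def G2_at_def)
    from G12 show False
    proof
      assume "\<forall>v w x a b y. {v,w,x,a,b,y} \<subseteq> V \<longrightarrow> distinct [v,w,x,a,b,y] \<longrightarrow> \<not> G1_at e v w x a b y"
      from this[rule_format, OF sub dist] at(1) show False by simp
    next
      assume "\<forall>v w x a b y. {v,w,x,a,b,y} \<subseteq> V \<longrightarrow> distinct [v,w,x,a,b,y] \<longrightarrow> \<not> G2_at e v w x a b y"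
      from this[rule_format, OF sub dist] at(2) show False by simp
    qed
  qed
qed (auto simp: F_tuples_def)

lemma tuple_dichotomy:
  assumes e: "symmetric3 e" and t: "t \<in> tuples V 6"
    and good: "\<And>i j. i < 6 \<Longrightarrow> j < 6 \<Longrightarrow> i \<noteq> j \<Longrightarrow> t \<notin> repeating V i j"
      "\<And>p. p \<in> perms6 \<Longrightarrow> t \<notin> F_tuples V e p"
    and G12: "(\<forall>v w x a b y. {v,w,x,a,b,y} \<subseteq> V \<longrightarrow> distinct [v,w,x,a,b,y] \<longrightarrow> \<not> G1_at e v w x a b y) \<or>
              (\<forall>v w x a b y. {v,w,x,a,b,y} \<subseteq> V \<longrightarrow> distinct [v,w,x,a,b,y] \<longrightarrow> \<not> G2_at e v w x a b y)"
  shows "(\<Sum>p\<in>perms6. local_term e (pick t p)) \<le> 0"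
proof (rule local_sum_nonpos[OF e])
  show len: "length t = 6" using t by (simp add: tuples_def)
  show dt: "distinct t" using good(1) t len by (auto simp: repeating_def distinct_conv_nth)
  have tV: "set t \<subseteq> V" using t by (simp add: tuples_def)
  fix v x a b y assume sub: "{v,x,a,b,y} \<subseteq> set t" and dist: "distinct [v,x,a,b,y]"
  have "\<exists>i<6. t ! i = u" if "u \<in> set t" for u using that len by (metis in_set_conv_nth)
  note ex = this
  obtain iv where iv: "iv < 6" "t ! iv = v" using ex[of v] sub by auto
  obtain ix where ix: "ix < 6" "t ! ix = x" using ex[of x] sub by auto
  obtain ia where ia: "ia < 6" "t ! ia = a" using ex[of a] sub by auto
  obtain ib where ib: "ib < 6" "t ! ib = b" using ex[of b] sub by auto
  obtain iy where iy: "iy < 6" "t ! iy = y" using ex[of y] sub by auto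
  note i = iv ix ia ib iy
  have di: "distinct [iv,ix,ia,ib,iy]" using dist i by auto
  obtain iz where iz: "iz < 6" "iz \<notin> set [iv,ix,ia,ib,iy]"
  proof (rule ccontr)
    assume "\<not> thesis"
    then have "{..<6} \<subseteq> set [iv,ix,ia,ib,iy]" using that by (intro subsetI) (metis lessThan_iff)
    then have "card {..<6::nat} \<le> card (set [iv,ix,ia,ib,iy])" by (intro card_mono finite_set)
    then show False using distinct_card[OF di] by simp
  qed
  let ?p = "[iv,ix,ia,ib,iy,iz]"
  have "?p \<in> perms6" unfolding perms6_alt using di iz i by auto
  then have "t \<notin> F_tuples V e ?p" by (rule good(2))
  then show "\<not> F_at e v x a b y" using t dt i by (simp add: F_tuples_def)
next
  have tV: "set t \<subseteq> V" using t by (simp add: tuples_def)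
  show "(\<forall>v w x a b y. {v,w,x,a,b,y} \<subseteq> set t \<longrightarrow> distinct [v,w,x,a,b,y] \<longrightarrow> \<not> G1_at e v w x a b y) \<or>
        (\<forall>v w x a b y. {v,w,x,a,b,y} \<subseteq> set t \<longrightarrow> distinct [v,w,x,a,b,y] \<longrightarrow> \<not> G2_at e v w x a b y)"
    using G12
  proof
    assume h: "\<forall>v w x a b y. {v,w,x,a,b,y} \<subseteq> V \<longrightarrow> distinct [v,w,x,a,b,y] \<longrightarrow> \<not> G1_at e v w x a b y"
    show ?thesis by (intro disjI1 allI impI, rule h[rule_format], erule subset_trans[OF _ tV], assumption)
  next
    assume h: "\<forall>v w x a b y. {v,w,x,a,b,y} \<subseteq> V \<longrightarrow> distinct [v,w,x,a,b,y] \<longrightarrow> \<not> G2_at e v w x a b y"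
    show ?thesis by (intro disjI2 allI impI, rule h[rule_format], erule subset_trans[OF _ tV], assumption)
  qed
qed

text \<open>The sum is symmetrised over the orderings. The good tuples contribute at most $0$, and there are
  at most $(36 + 46656) n^5$ others.\<close>

lemma sum_local_tuples_le:
  assumes V: "finite V" and e: "symmetric3 e"
    and G12: "(\<forall>v w x a b y. {v,w,x,a,b,y} \<subseteq> V \<longrightarrow> distinct [v,w,x,a,b,y] \<longrightarrow> \<not> G1_at e v w x a b y) \<or>
              (\<forall>v w x a b y. {v,w,x,a,b,y} \<subseteq> V \<longrightarrow> distinct [v,w,x,a,b,y] \<longrightarrow> \<not> G2_at e v w x a b y)"
  shows "(\<Sum>t\<in>tuples V 6. local_term e t) \<le> 150000000000000 * int (card V) ^ 5"
proof -
  let ?I = "{(i, j). i < (6::nat) \<and> j < (6::nat) \<and> i \<noteq> j}"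
  let ?Bad = "(\<Union>(i, j)\<in>?I. repeating V i j) \<union> (\<Union>p\<in>perms6. F_tuples V e p)"
  let ?n5 = "card V ^ 5"
  let ?s = "\<lambda>t. \<Sum>p\<in>perms6. local_term e (pick t p)"
  have finI: "finite ?I" by (rule finite_subset[of _ "{..<6} \<times> {..<6}"]) auto
  have cI: "card ?I \<le> 36" using card_mono[of "{..<6::nat} \<times> {..<6::nat}" ?I] by auto
  have BadT: "?Bad \<subseteq> tuples V 6" by (auto simp: repeating_def F_tuples_def)
  then have finB: "finite ?Bad" using finite_tuples[OF V] finite_subset by blast
  have "card (\<Union>(i, j)\<in>?I. repeating V i j) \<le> (\<Sum>ij\<in>?I. card (case ij of (i, j) \<Rightarrow> repeating V i j))"
    by (rule card_UN_le[OF finI])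
  also have "\<dots> \<le> (\<Sum>ij\<in>?I. ?n5)" by (rule sum_mono) (use card_repeating[OF V] in auto)
  also have "\<dots> \<le> 36 * ?n5" using cI by simp
  finally have rep: "card (\<Union>(i, j)\<in>?I. repeating V i j) \<le> 36 * ?n5" .
  have "card (\<Union>p\<in>perms6. F_tuples V e p) \<le> (\<Sum>p\<in>perms6. card (F_tuples V e p))"
    by (rule card_UN_le[OF finite_perms6])
  also have "\<dots> \<le> (\<Sum>p\<in>perms6. ?n5)" by (rule sum_mono, rule card_F_tuples[OF V _ G12])
  also have "\<dots> \<le> 46656 * ?n5" using card_perms6 by simp
  finally have copies: "card (\<Union>p\<in>perms6. F_tuples V e p) \<le> 46656 * ?n5" .
  have "card ?Bad \<le> card (\<Union>(i, j)\<in>?I. repeating V i j) + card (\<Union>p\<in>perms6. F_tuples V e p)"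
    by (rule card_Un_le)
  then have "card ?Bad \<le> 50000 * ?n5" using rep copies by linarith
  then have cB: "int (card ?Bad) \<le> int (50000 * ?n5)" by (simp only: of_nat_le_iff)
  have up: "?s t \<le> int (card perms6) * 3000000000" for t
    by (rule sum_bounded_above) (rule local_term_bound)
  have good: "?s t \<le> 0" if "t \<in> tuples V 6 - ?Bad" for t
  proof (rule tuple_dichotomy[OF e _ _ _ G12])
    show "t \<in> tuples V 6" using that by simp
    show "t \<notin> repeating V i j" if "i < 6" "j < 6" "i \<noteq> j" for i j
      using \<open>t \<in> tuples V 6 - ?Bad\<close> that by auto
    show "t \<notin> F_tuples V e p" if "p \<in> perms6" for p
      using \<open>t \<in> tuples V 6 - ?Bad\<close> that by auto
  qed
  have "int (card perms6) * (\<Sum>t\<in>tuples V 6. local_term e t) = (\<Sum>t\<in>tuples V 6. ?s t)"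
    using sum_tuples_symmetrise[OF V, of "local_term e"] by simp
  also have "\<dots> = (\<Sum>t\<in>tuples V 6 - ?Bad. ?s t) + (\<Sum>t\<in>?Bad. ?s t)"
    by (rule sum.subset_diff[OF BadT finite_tuples[OF V]])
  also have "\<dots> \<le> 0 + (\<Sum>t\<in>?Bad. int (card perms6) * 3000000000)"
    by (intro add_mono sum_nonpos sum_mono good up)
  also have "\<dots> = int (card perms6) * (3000000000 * int (card ?Bad))" by simp
  also have "\<dots> \<le> int (card perms6) * (3000000000 * int (50000 * ?n5))"
    by (intro mult_left_mono cB of_nat_0_le_iff zero_le_numeral)
  finally have "int (card perms6) * (\<Sum>t\<in>tuples V 6. local_term e t)
      \<le> int (card perms6) * (150000000000000 * int (card V) ^ 5)" by simp
  moreover have "[0,1,2,3,4,5] \<in> perms6" by (auto simp: perms6_def)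
  then have "0 < int (card perms6)" using finite_perms6 by (auto simp: card_gt_0_iff)
  ultimately show ?thesis by (simp only: mult_le_cancel_left_pos)
qed

text \<open>The difference of the two sides is half the sum of all $(f(x) - f(y))^2$.\<close>

lemma sum_power2_le:
  fixes f :: "'a \<Rightarrow> real"
  shows "(\<Sum>x\<in>V. f x) ^ 2 \<le> real (card V) * (\<Sum>x\<in>V. f x ^ 2)"
proof -
  have "0 \<le> (\<Sum>x\<in>V. \<Sum>y\<in>V. (f x - f y) ^ 2)" by (intro sum_nonneg) auto
  also have "\<dots> = (\<Sum>x\<in>V. \<Sum>y\<in>V. f x * f x + f y * f y - 2 * (f x * f y))"
    by (simp add: power2_eq_square algebra_simps)
  also have "\<dots> = 2 * (real (card V) * (\<Sum>x\<in>V. f x * f x)) - 2 * ((\<Sum>x\<in>V. f x) * (\<Sum>x\<in>V. f x))"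
    by (simp only: sum.distrib sum_subtractf sum_constant sum_distrib_left[symmetric] sum_distrib_right[symmetric];
        simp)
  finally show ?thesis by (simp add: power2_eq_square)
qed

text \<open>If $S$ exceeded the bound, then $S(9S - 4n^3)$ would exceed $\frac{4}{9} n^3 \cdot 27 \cdot
  10^{10} n^2 = 12 \cdot 10^{10} n^5$, whereas the local inequality allows less than $3 \cdot
  10^{10} n^5$.\<close>

lemma degree_sum_bound:
  assumes V: "finite V" and e: "symmetric3 e"
    and G12: "(\<forall>v w x a b y. {v,w,x,a,b,y} \<subseteq> V \<longrightarrow> distinct [v,w,x,a,b,y] \<longrightarrow> \<not> G1_at e v w x a b y) \<or>
              (\<forall>v w x a b y. {v,w,x,a,b,y} \<subseteq> V \<longrightarrow> distinct [v,w,x,a,b,y] \<longrightarrow> \<not> G2_at e v w x a b y)"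
  shows "real_of_int (\<Sum>v\<in>V. degree V e v) \<le> 4 / 9 * real (card V) ^ 3 + 30000000000 * real (card V) ^ 2"
proof -
  let ?n = "real (card V)" and ?S = "real_of_int (\<Sum>v\<in>V. degree V e v)"
  let ?Q = "real_of_int (\<Sum>v\<in>V. degree V e v ^ 2)"
  have "6400 * (9 * (int (card V) * (\<Sum>v\<in>V. degree V e v ^ 2)) - 4 * (int (card V) ^ 3 * (\<Sum>v\<in>V. degree V e v)))
      \<le> 150000000000000 * int (card V) ^ 5"
    using sum_local_tuples_ge[of V e] sum_local_tuples_le[OF assms] by linarith
  then have "real_of_int (6400 * (9 * (int (card V) * (\<Sum>v\<in>V. degree V e v ^ 2))
      - 4 * (int (card V) ^ 3 * (\<Sum>v\<in>V. degree V e v)))) \<le> real_of_int (150000000000000 * int (card V) ^ 5)"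
    by (simp only: of_int_le_iff)
  then have main: "6400 * (9 * (?n * ?Q) - 4 * (?n ^ 3 * ?S)) \<le> 150000000000000 * ?n ^ 5"
    by (simp del: of_int_sum)
  have "?S ^ 2 \<le> ?n * ?Q"
    using sum_power2_le[of "\<lambda>v. real_of_int (degree V e v)" V] by simp
  then have key: "?S * (9 * ?S - 4 * ?n ^ 3) \<le> 150000000000000 / 6400 * ?n ^ 5"
    using main by (simp add: power2_eq_square algebra_simps del: of_int_sum)
  show ?thesis
  proof (rule ccontr)
    assume "\<not> ?thesis"
    then have big: "4 / 9 * ?n ^ 3 + 30000000000 * ?n ^ 2 < ?S" by simp
    have n: "?n > 0"
    proof (rule ccontr)
      assume "\<not> ?n > 0"
      then have "V = {}" using V by simp
      then show False using big by simp
    qed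
    have sq: "0 \<le> 30000000000 * ?n ^ 2" and cube: "0 < 4 / 9 * ?n ^ 3" using n by simp_all
    have "4 / 9 * ?n ^ 3 * (270000000000 * ?n ^ 2) < ?S * (9 * ?S - 4 * ?n ^ 3)"
    proof (rule mult_strict_mono)
      show "4 / 9 * ?n ^ 3 < ?S" using big sq by linarith
      show "270000000000 * ?n ^ 2 < 9 * ?S - 4 * ?n ^ 3" using big by simp
      show "0 < ?S" using big sq cube by linarith
    qed (use n in auto)
    also have "\<dots> \<le> 150000000000000 / 6400 * ?n ^ 5" by (rule key)
    finally have "120000000000 * ?n ^ 5 < 150000000000000 / 6400 * ?n ^ 5"
      by (simp add: power_add[symmetric] algebra_simps)
    then show False using n by simp
  qed
qed

section \<open>Back to hypergraphs\<close>

definition edge_rel :: "'v set set \<Rightarrow> 'v \<Rightarrow> 'v \<Rightarrow> 'v \<Rightarrow> bool" where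
  "edge_rel E a b c \<longleftrightarrow> {a, b, c} \<in> E"

lemma symmetric3_edge_rel: "symmetric3 (edge_rel E)"
  unfolding symmetric3_def edge_rel_def by (metis insert_commute)

text \<open>Each edge is counted once for each ordering of its three vertices.\<close>

lemma degree_sum_eq:
  fixes G :: "'v hypergraph"
  assumes G: "three_graph G"
  shows "(\<Sum>v\<in>verts G. degree (verts G) (edge_rel (edges G)) v) = 6 * int (card (edges G))"
proof -
  let ?V = "verts G" and ?E = "edges G"
  have V: "finite ?V" and E: "\<And>e. e \<in> ?E \<Longrightarrow> e \<subseteq> ?V \<and> card e = 3" using G by (auto simp: three_graph_def)
  have finE: "finite ?E" by (rule finite_subset[of _ "Pow ?V"]) (use E V in auto)
  let ?T = "\<lambda>e. {(a, b, c). {a, b, c} = e}"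
  have T: "card (?T e) = 6 \<and> finite (?T e)" if "e \<in> ?E" for e
  proof -
    have c: "card e = 3" using E[OF that] by simp
    obtain x y z where e: "e = {x, y, z}" "x \<noteq> y" "x \<noteq> z" "y \<noteq> z"
      using c by (metis card_3_iff)
    have "?T e = {(x,y,z),(x,z,y),(y,x,z),(y,z,x),(z,x,y),(z,y,x)}"
    proof (intro equalityI subsetI)
      fix p assume "p \<in> ?T e"
      then obtain a b d where p: "p = (a, b, d)" and eq: "{a, b, d} = {x, y, z}" using e(1) by auto
      have "a \<in> {x, y, z}" "b \<in> {x, y, z}" "d \<in> {x, y, z}" using eq by blast+
      moreover have "x \<in> {a, b, d}" "y \<in> {a, b, d}" "z \<in> {a, b, d}" using eq by blast+
      ultimately show "p \<in> {(x,y,z),(x,z,y),(y,x,z),(y,z,x),(z,x,y),(z,y,x)}" using e(2-4) p by auto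
    qed (auto simp: e(1))
    then show ?thesis using e(2-4) by simp
  qed
  have "(\<Sum>v\<in>?V. degree ?V (edge_rel ?E) v) = (\<Sum>(a, b, c)\<in>?V \<times> ?V \<times> ?V. of_bool ({a, b, c} \<in> ?E))"
    unfolding degree_def edge_rel_def by (simp add: sum.cartesian_product)
  also have "\<dots> = int (card {(a, b, c)\<in>?V \<times> ?V \<times> ?V. {a, b, c} \<in> ?E})"
    using V by (simp add: case_prod_beta sum.If_cases of_bool_def Int_def) (rule arg_cong[where f = card], auto)
  also have "{(a, b, c)\<in>?V \<times> ?V \<times> ?V. {a, b, c} \<in> ?E} = (\<Union>e\<in>?E. ?T e)"
    using E by auto
  also have "card (\<Union>e\<in>?E. ?T e) = (\<Sum>e\<in>?E. card (?T e))"
    by (rule card_UN_disjoint[OF finE]) (use T in auto)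
  also have "\<dots> = 6 * card ?E" using T by simp
  finally show ?thesis by simp
qed

lemma subgraph_copy:
  fixes G :: "'v hypergraph" and f :: "'a \<Rightarrow> 'v"
  assumes G: "three_graph G" and F: "three_graph F" and f: "inj_on f (verts F)" "f ` verts F \<subseteq> verts G"
    and edges: "\<And>s. s \<in> edges F \<Longrightarrow> f ` s \<in> edges G"
  shows "\<not> free_of {F} G"
proof -
  let ?H = "(f ` verts F, (\<lambda>s. f ` s) ` edges F)"
  have FE: "s \<subseteq> verts F" "card s = 3" if "s \<in> edges F" for s using that F by (auto simp: three_graph_def)
  have cf: "card (f ` s) = 3" if "s \<in> edges F" for s
    using card_image[OF inj_on_subset[OF f(1) FE(1)[OF that]]] FE(2)[OF that] by simp
  have "subgraph ?H G"
    unfolding subgraph_def three_graph_def using cf F f(2) edges G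
    by (auto simp: three_graph_def; use FE(1) in blast)
  moreover have "isomorphic F ?H" unfolding isomorphic_def using f by (auto simp: bij_betw_def)
  ultimately show ?thesis unfolding free_of_def by blast
qed

text \<open>The list in the definition of \<open>f\<close> names the images of the vertices $1, \dots, 6$.\<close>

lemma no_G1_at:
  fixes G :: "'v hypergraph"
  assumes G: "three_graph G" and free: "free_of {G1} G"
    and vs: "{v,w,x,a,b,y} \<subseteq> verts G" "distinct [v,w,x,a,b,y]"
  shows "\<not> G1_at (edge_rel (edges G)) v w x a b y"
proof
  assume at: "G1_at (edge_rel (edges G)) v w x a b y"
  define f where "f i = [x,v,a,b,y,w] ! (i - 1)" for i :: nat
  have f: "f 1 = x" "f 2 = v" "f 3 = a" "f 4 = b" "f 5 = y" "f 6 = w" by (simp_all add: f_def)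
  have v6: "{1..6} = {1,2,3,4,5,6::nat}" "{Suc 0..6} = {Suc 0,2,3,4,5,6::nat}" by auto
  have "\<not> free_of {G1} G"
  proof (rule subgraph_copy[OF G three_graph_G1, where f = f])
    show "inj_on f (verts G1)" using vs(2) by (auto simp: G1_def v6 f[simplified])
    show "f ` verts G1 \<subseteq> verts G" using vs(1) by (auto simp: G1_def v6 f[simplified])
    show "f ` s \<in> edges G" if "s \<in> edges G1" for s
      using that at by (auto simp: G1_def f[simplified] G1_at_def edge_rel_def insert_commute)
  qed
  then show False using free by simp
qed

lemma no_G2_at:
  fixes G :: "'v hypergraph"
  assumes G: "three_graph G" and free: "free_of {G2} G"
    and vs: "{v,w,x,a,b,y} \<subseteq> verts G" "distinct [v,w,x,a,b,y]"
  shows "\<not> G2_at (edge_rel (edges G)) v w x a b y"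
proof
  assume at: "G2_at (edge_rel (edges G)) v w x a b y"
  define f where "f i = [x,a,v,b,y,w] ! (i - 1)" for i :: nat
  have f: "f 1 = x" "f 2 = a" "f 3 = v" "f 4 = b" "f 5 = y" "f 6 = w" by (simp_all add: f_def)
  have v6: "{1..6} = {1,2,3,4,5,6::nat}" "{Suc 0..6} = {Suc 0,2,3,4,5,6::nat}" by auto
  have "\<not> free_of {G2} G"
  proof (rule subgraph_copy[OF G three_graph_G2, where f = f])
    show "inj_on f (verts G2)" using vs(2) by (auto simp: G2_def v6 f[simplified])
    show "f ` verts G2 \<subseteq> verts G" using vs(1) by (auto simp: G2_def v6 f[simplified])
    show "f ` s \<in> edges G" if "s \<in> edges G2" for s
      using that at by (auto simp: G2_def f[simplified] G2_at_def edge_rel_def insert_commute)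
  qed
  then show False using free by simp
qed

lemma edge_bound:
  fixes G :: "'v hypergraph"
  assumes G: "three_graph G" and n: "card (verts G) = n" and free: "free_of {G1} G \<or> free_of {G2} G"
  shows "6 * real (card (edges G)) \<le> 4 / 9 * real n ^ 3 + 30000000000 * real n ^ 2"
proof -
  have "finite (verts G)" using G by (simp add: three_graph_def)
  moreover have "(\<forall>v w x a b y. {v,w,x,a,b,y} \<subseteq> verts G \<longrightarrow> distinct [v,w,x,a,b,y] \<longrightarrow>
                    \<not> G1_at (edge_rel (edges G)) v w x a b y) \<or>
                 (\<forall>v w x a b y. {v,w,x,a,b,y} \<subseteq> verts G \<longrightarrow> distinct [v,w,x,a,b,y] \<longrightarrow>
                    \<not> G2_at (edge_rel (edges G)) v w x a b y)"
    using free
  proof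
    assume "free_of {G1} G"
    show ?thesis by (intro disjI1 allI impI, rule no_G1_at[OF G \<open>free_of {G1} G\<close>])
  next
    assume "free_of {G2} G"
    show ?thesis by (intro disjI2 allI impI, rule no_G2_at[OF G \<open>free_of {G2} G\<close>])
  qed
  ultimately have "real_of_int (\<Sum>v\<in>verts G. degree (verts G) (edge_rel (edges G)) v)
      \<le> 4 / 9 * real (card (verts G)) ^ 3 + 30000000000 * real (card (verts G)) ^ 2"
    by (rule degree_sum_bound[OF _ symmetric3_edge_rel])
  then show ?thesis unfolding degree_sum_eq[OF G] n by simp
qed

theorem theorem14:
  shows "\<not> colourable_2_1 G1 \<and> \<not> colourable_2_1 G2 \<and>
         turan_density {G1} = 4 / 9 \<and> turan_density {G2} = 4 / 9"
proof (intro conjI)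
  show "turan_density {G1} = 4 / 9"
    by (rule turan_density_eqI[OF G1_not_colourable]) (rule edge_bound; simp)
  show "turan_density {G2} = 4 / 9"
    by (rule turan_density_eqI[OF G2_not_colourable]) (rule edge_bound; simp)
qed (rule G1_not_colourable G2_not_colourable)+

end
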